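(* Let $A = \{ a \in N : p(a u_k - a) + p(u_k a - a) \to 0 \text{ as } k \to \infty\}$. Then the operator algebra $A$ is not nc-discrete.
   Context: For an operator algebra $A$ with a contractive approximate identity, $A^{**}$ is an operator algebra with its Arens product, with identity $1_{A^{**}}$ of norm $1$. A projection means an orthogonal projection. A projection $q \in A^{**}$ is open if there is a net $(x_t)$ in $A$ with $x_t = q x_t \to q$ weak*; $q$ is closed if $1_{A^{**}} - q$ is open. $A$ is nc-discrete if every open projection in $A^{**}$ is also closed. (Equivalently, every open projection in $A^{**}$ lies in the multiplier algebra $M(A) = \{\alpha \in A^{**} : \alpha A \subset A,\ A\alpha \subset A\}$.) Here $\mathbb{N}=\{1,2,\dots\}$, $\mathbb{N}_0 = \mathbb{N}\cup\{0\}$, $M_n=M_n(\mathbb{C})$ with operator norm $\|\cdot\|$. Let $(c_n)$ be an unbounded increasing sequence in $(0,\infty)$ with $c_n > 1$ for all $n$. Let $d_n \in M_n$ be the diagonal matrix whose $k$th diagonal entry is $c_n^k$. Let $M$ be the von Neumann algebra $\oplus_n^\infty (M_n \oplus M_n)$ ($\ell^\infty$-direct sum), and let $N \subset M$ be the weak*-closed unital subalgebra of all tuples $((x_n, d_n x_n d_n^{-1}))_n$ that lie in $M$, with $(x_n) \in \oplus_n^\infty M_n$; such a tuple is also written simply $(x_n)$. The norm on $N$ is $p((x_n)) = \sup_n p_n(x_n)$, where $p_n(x) = \max\{\|x\|, \|d_n x d_n^{-1}\|\}$ for $x \in M_n$. Let $L_n \in M_n$ be the left shift on $\mathbb{C}^n$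 ($L_n e_1 = 0$, $L_n e_{j+1} = e_j$). For $n \ge k$ put $E_{n,k} = \mathbb{N}_0 \cap [\frac{n}{k}, \frac{2n}{k}]$, $\mu_{n,k} = |E_{n,k}|$, and $u_{n,k} = \frac{1}{\mu_{n,k}} \sum_{i \in E_{n,k}} (L_n)^i$; for $n < k$ put $u_{n,k} = I_n$. Set $u_k = (u_{n,k})_{n \in \mathbb{N}} \in N$. The algebra $A$ has $(u_k)$ as a contractive approximate identity. *)

theory Defs
  imports "HOL-Analysis.L2_Norm" "Jordan_Normal_Form.Schur_Decomposition"
begin

section \<open>Normed spaces and algebras with explicit carriers\<close>

record 'a nspace =
  Carr :: "'a set"
  Plus :: "'a \<Rightarrow> 'a \<Rightarrow> 'a"
  Scale :: "complex \<Rightarrow> 'a \<Rightarrow> 'a"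
  Norm :: "'a \<Rightarrow> real"

record 'a star_algebra = "'a nspace" +
  Times :: "'a \<Rightarrow> 'a \<Rightarrow> 'a"
  Star :: "'a \<Rightarrow> 'a"

definition Minus :: "('a, 'm) nspace_scheme \<Rightarrow> 'a \<Rightarrow> 'a \<Rightarrow> 'a" where
  "Minus X x y = Plus X x (Scale X (- 1) y)"

text \<open>A subalgebra \<open>A\<close> of \<open>B\<close> is the structure \<open>B\<close> with a smaller carrier; its \<open>Star\<close> field is
  then meaningless unless \<open>A\<close> is selfadjoint, and is not used in that case.\<close>

definition subalg :: "'a star_algebra \<Rightarrow> 'a set \<Rightarrow> 'a star_algebra" where
  "subalg B A = B\<lparr>Carr := A\<rparr>"

section \<open>Duals, biduals and the Arens product\<close>

text \<open>Complex-linear bounded functionals; \<open>extensional\<close> makes equality of functions the same as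
  equality of functionals.\<close>

definition dual_carrier :: "('a, 'm) nspace_scheme \<Rightarrow> ('a \<Rightarrow> complex) set" where
  "dual_carrier X = {\<phi> \<in> extensional (Carr X).
     (\<forall>x \<in> Carr X. \<forall>y \<in> Carr X. \<phi> (Plus X x y) = \<phi> x + \<phi> y) \<and>
     (\<forall>z. \<forall>x \<in> Carr X. \<phi> (Scale X z x) = z * \<phi> x) \<and>
     (\<exists>K. \<forall>x \<in> Carr X. cmod (\<phi> x) \<le> K * Norm X x)}"

definition dual :: "('a, 'm) nspace_scheme \<Rightarrow> ('a \<Rightarrow> complex) nspace" where
  "dual X =
     \<lparr> Carr = dual_carrier X,
       Plus = (\<lambda>\<phi> \<psi>. \<lambda>x \<in> Carr X. \<phi> x + \<psi> x),
       Scale = (\<lambda>z \<phi>. \<lambda>x \<in> Carr X. z * \<phi> x),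
       Norm = (\<lambda>\<phi>. SUP x \<in> {x \<in> Carr X. Norm X x \<le> 1}. cmod (\<phi> x)) \<rparr>"

text \<open>The module actions \<open>(\<phi>\<cdot>a)(b) = \<phi>(ab)\<close> and \<open>(n\<cdot>\<phi>)(a) = n(\<phi>\<cdot>a)\<close> and the first Arens product
  \<open>(mn)(\<phi>) = m(n\<cdot>\<phi>)\<close>. Operator algebras are Arens regular, so the second Arens product is the
  same.\<close>

definition dual_act :: "'a star_algebra \<Rightarrow> ('a \<Rightarrow> complex) \<Rightarrow> 'a \<Rightarrow> ('a \<Rightarrow> complex)" where
  "dual_act X \<phi> a = (\<lambda>b \<in> Carr X. \<phi> (Times X a b))"

definition bidual_act ::
  "'a star_algebra \<Rightarrow> (('a \<Rightarrow> complex) \<Rightarrow> complex) \<Rightarrow> ('a \<Rightarrow> complex) \<Rightarrow> ('a \<Rightarrow> complex)" where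
  "bidual_act X n \<phi> = (\<lambda>a \<in> Carr X. n (dual_act X \<phi> a))"

definition arens ::
  "'a star_algebra \<Rightarrow> (('a \<Rightarrow> complex) \<Rightarrow> complex) \<Rightarrow> (('a \<Rightarrow> complex) \<Rightarrow> complex)
     \<Rightarrow> (('a \<Rightarrow> complex) \<Rightarrow> complex)" where
  "arens X m n = (\<lambda>\<phi> \<in> Carr (dual X). m (bidual_act X n \<phi>))"

text \<open>The involution: \<open>\<phi>\<^sup>*(x) = cnj (\<phi>(x\<^sup>*))\<close> on the dual and \<open>m\<^sup>*(\<phi>) = cnj (m(\<phi>\<^sup>*))\<close> on the bidual
  (meaningful if the carrier is selfadjoint).\<close>

definition dual_star :: "'a star_algebra \<Rightarrow> ('a \<Rightarrow> complex) \<Rightarrow> ('a \<Rightarrow> complex)" where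
  "dual_star X \<phi> = (\<lambda>x \<in> Carr X. cnj (\<phi> (Star X x)))"

definition bidual :: "'a star_algebra \<Rightarrow> (('a \<Rightarrow> complex) \<Rightarrow> complex) star_algebra" where
  "bidual X =
     \<lparr> Carr = Carr (dual (dual X)),
       Plus = Plus (dual (dual X)),
       Scale = Scale (dual (dual X)),
       Norm = Norm (dual (dual X)),
       Times = arens X,
       Star = (\<lambda>m. \<lambda>\<phi> \<in> Carr (dual X). cnj (m (dual_star X \<phi>))) \<rparr>"

definition canon :: "'a star_algebra \<Rightarrow> 'a \<Rightarrow> (('a \<Rightarrow> complex) \<Rightarrow> complex)" where
  "canon X x = (\<lambda>\<phi> \<in> Carr (dual X). \<phi> x)"

definition is_identity :: "'a star_algebra \<Rightarrow> 'a \<Rightarrow> bool" where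
  "is_identity X e \<longleftrightarrow> e \<in> Carr X \<and> (\<forall>x \<in> Carr X. Times X e x = x \<and> Times X x e = x)"

lemma is_identity_unique: "is_identity X e \<Longrightarrow> is_identity X f \<Longrightarrow> e = f"
  unfolding is_identity_def by metis

section \<open>Open and closed projections, nc-discreteness\<close>

definition is_proj :: "'a star_algebra \<Rightarrow> 'a \<Rightarrow> bool" where
  "is_proj X q \<longleftrightarrow> q \<in> Carr X \<and> Times X q q = q \<and> Star X q = q"

text \<open>Throughout, the operator algebra \<open>A\<close> is a subalgebra of the C*-algebra \<open>B\<close>. The second
  adjoint of the inclusion identifies the bidual of \<open>A\<close> with a subalgebra of the von Neumann algebra
  \<open>B\<^sup>*\<^sup>*\<close>, and this is the operator algebra structure of the bidual of \<open>A\<close>; its orthogonal projections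
  are the elements that become selfadjoint idempotents in \<open>B\<^sup>*\<^sup>*\<close>.\<close>

definition bidual_incl ::
  "'a star_algebra \<Rightarrow> 'a set \<Rightarrow> (('a \<Rightarrow> complex) \<Rightarrow> complex) \<Rightarrow> (('a \<Rightarrow> complex) \<Rightarrow> complex)" where
  "bidual_incl B A m = (\<lambda>\<phi> \<in> Carr (dual B). m (restrict \<phi> A))"

definition projection ::
  "'a star_algebra \<Rightarrow> 'a set \<Rightarrow> (('a \<Rightarrow> complex) \<Rightarrow> complex) \<Rightarrow> bool" where
  "projection B A q \<longleftrightarrow>
     q \<in> Carr (bidual (subalg B A)) \<and> is_proj (bidual B) (bidual_incl B A q)"

text \<open>A net in \<open>A\<close> is given by the proper filter of its tails.\<close>

definition open_projection ::
  "'a star_algebra \<Rightarrow> 'a set \<Rightarrow> (('a \<Rightarrow> complex) \<Rightarrow> complex) \<Rightarrow> bool" where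
  "open_projection B A q \<longleftrightarrow> projection B A q \<and>
     (\<exists>F. F \<noteq> bot \<and>
        (\<forall>\<^sub>F x in F. x \<in> A \<and>
           canon (subalg B A) x = Times (bidual (subalg B A)) q (canon (subalg B A) x)) \<and>
        (\<forall>\<phi> \<in> Carr (dual (subalg B A)). ((\<lambda>x. \<phi> x) \<longlongrightarrow> q \<phi>) F))"

text \<open>The identity of the bidual of \<open>A\<close> is unique (\<open>is_identity_unique\<close>), and it exists whenever
  \<open>A\<close> has a contractive approximate identity; the notions below are meant for such \<open>A\<close>.\<close>

definition closed_projection ::
  "'a star_algebra \<Rightarrow> 'a set \<Rightarrow> (('a \<Rightarrow> complex) \<Rightarrow> complex) \<Rightarrow> bool" where
  "closed_projection B A q \<longleftrightarrow> projection B A q \<and>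
     (\<exists>e. is_identity (bidual (subalg B A)) e \<and>
        open_projection B A (Minus (bidual (subalg B A)) e q))"

definition nc_discrete :: "'a star_algebra \<Rightarrow> 'a set \<Rightarrow> bool" where
  "nc_discrete B A \<longleftrightarrow> (\<forall>q. open_projection B A q \<longrightarrow> closed_projection B A q)"

section \<open>The von Neumann algebra M\<close>

definition l2norm :: "complex vec \<Rightarrow> real" where
  "l2norm v = L2_set (\<lambda>i. cmod (v $ i)) {..<dim_vec v}"

definition opnorm :: "complex mat \<Rightarrow> real" where
  "opnorm X = (SUP v \<in> {v \<in> carrier_vec (dim_col X). l2norm v \<le> 1}. l2norm (X *\<^sub>v v))"

type_synonym tuple = "nat \<Rightarrow> complex mat \<times> complex mat"

definition M_alg :: "tuple star_algebra" where
  "M_alg =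
     \<lparr> Carr = {x \<in> (\<Pi>\<^sub>E n\<in>{1..}. carrier_mat n n \<times> carrier_mat n n).
                \<exists>K. \<forall>n\<ge>1. max (opnorm (fst (x n))) (opnorm (snd (x n))) \<le> K},
       Plus = (\<lambda>x y. \<lambda>n \<in> {1..}. (fst (x n) + fst (y n), snd (x n) + snd (y n))),
       Scale = (\<lambda>z x. \<lambda>n \<in> {1..}. (z \<cdot>\<^sub>m fst (x n), z \<cdot>\<^sub>m snd (x n))),
       Norm = (\<lambda>x. SUP n \<in> {1..}. max (opnorm (fst (x n))) (opnorm (snd (x n)))),
       Times = (\<lambda>x y. \<lambda>n \<in> {1..}. (fst (x n) * fst (y n), snd (x n) * snd (y n))),
       Star = (\<lambda>x. \<lambda>n \<in> {1..}. (mat_adjoint (fst (x n)), mat_adjoint (snd (x n)))) \<rparr>"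

section \<open>The algebras N and A\<close>

text \<open>Matrix indices start at \<open>0\<close>, so the \<open>k\<close>th diagonal entry has index \<open>k - 1\<close>.\<close>

definition d_mat :: "(nat \<Rightarrow> real) \<Rightarrow> nat \<Rightarrow> complex mat" where
  "d_mat c n = mat_diag n (\<lambda>i. complex_of_real (c n ^ Suc i))"

definition d_inv :: "(nat \<Rightarrow> real) \<Rightarrow> nat \<Rightarrow> complex mat" where
  "d_inv c n = mat_diag n (\<lambda>i. complex_of_real (inverse (c n ^ Suc i)))"

lemma d_mat_inverse:
  assumes "c n \<noteq> 0"
  shows "d_mat c n * d_inv c n = 1\<^sub>m n" "d_inv c n * d_mat c n = 1\<^sub>m n"
proof -
  have "complex_of_real (c n ^ Suc i) * complex_of_real (inverse (c n ^ Suc i)) = 1" for i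
    using assms by (metis of_real_1 of_real_mult power_not_zero right_inverse)
  then show "d_mat c n * d_inv c n = 1\<^sub>m n" "d_inv c n * d_mat c n = 1\<^sub>m n"
    unfolding d_mat_def d_inv_def mat_diag_diag
    by (simp_all only: mult.commute[of "complex_of_real (inverse _)"] mat_diag_one)
qed

definition tup :: "(nat \<Rightarrow> real) \<Rightarrow> (nat \<Rightarrow> complex mat) \<Rightarrow> tuple" where
  "tup c x = (\<lambda>n \<in> {1..}. (x n, d_mat c n * x n * d_inv c n))"

definition N_alg :: "(nat \<Rightarrow> real) \<Rightarrow> tuple set" where
  "N_alg c = {tup c x | x. \<forall>n\<ge>1. x n \<in> carrier_mat n n} \<inter> Carr M_alg"

definition shiftL :: "nat \<Rightarrow> complex mat" where
  "shiftL n = mat n n (\<lambda>(i, j). if j = Suc i then 1 else 0)"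

definition E_set :: "nat \<Rightarrow> nat \<Rightarrow> nat set" where
  "E_set n k = {i. real n / real k \<le> real i \<and> real i \<le> 2 * real n / real k}"

definition u_mat :: "nat \<Rightarrow> nat \<Rightarrow> complex mat" where
  "u_mat n k =
     (if n \<ge> k
      then mat n n (\<lambda>(r, s). 1 / of_nat (card (E_set n k)) *
                             (\<Sum>i \<in> E_set n k. (shiftL n ^\<^sub>m i) $$ (r, s)))
      else 1\<^sub>m n)"

definition u_tup :: "(nat \<Rightarrow> real) \<Rightarrow> nat \<Rightarrow> tuple" where
  "u_tup c k = tup c (\<lambda>n. u_mat n k)"

text \<open>The norm \<open>p\<close> of \<open>N\<close> is the one inherited from \<open>M\<close>.\<close>

definition A_alg :: "(nat \<Rightarrow> real) \<Rightarrow> tuple set" where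
  "A_alg c = {a \<in> N_alg c.
     (\<lambda>k. Norm M_alg (Minus M_alg (Times M_alg a (u_tup c k)) a)
         + Norm M_alg (Minus M_alg (Times M_alg (u_tup c k) a) a)) \<longlonglongrightarrow> 0}"

end

theory Submission
  imports Defs "HOL-Analysis.Function_Topology" "HOL-Analysis.Topology_Euclidean_Space"
begin

text \<open>Let \<open>p\<^sub>m \<in> A\<close> be the identity on the first \<open>m\<close> blocks and \<open>0\<close> on the others. A weak* limit \<open>q\<close> of
  \<open>(p\<^sub>m)\<close> is an open projection, the support projection of the ideal of null sequences in \<open>A\<close>. If
  \<open>q\<close> were closed, \<open>e - q\<close> would be a weak* limit of elements \<open>x\<close> with \<open>x = (e - q)x\<close>; such an \<open>x\<close>
  vanishes in every block, so \<open>q = e\<close>. But \<open>q\<close> annihilates every functional on \<open>A\<close> that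
  kills the null sequences, for instance the generalized limit of the normalized sums of the entries
  of the first components. This functional is nonzero at the element of \<open>A\<close> with blocks
  \<open>(1/n)(1 + L\<^sub>n + \<dots> + L\<^sub>n\<^bsup>n-1\<^esup>)\<close>, which belongs to \<open>A\<close> because multiplying it by \<open>L\<^sub>n\<^bsup>i\<^esup>\<close> with
  \<open>i \<le> 2n/k\<close> changes it by at most \<open>2/k\<close> in norm.\<close>

text \<open>The contradiction is a failed interchange of limits. Let \<open>a\<close> be the
  averaging element and \<open>\<tau> n\<close> the mean over block \<open>n\<close>. For fixed
  \<open>m\<close> the limit over \<open>n\<close> of \<open>\<tau> n\<close> at
  \<open>p\<^sub>m a\<close> is zero, because only the first \<open>m\<close> blocks survive; for
  fixed \<open>n\<close> the limit over \<open>m\<close> is \<open>\<tau> n a\<close>, at least 1/2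
  in modulus. Limits in both variables are taken along one filter \<open>G\<close>, which turns
  bounded sequences of functionals into functionals by pointwise limits. The identity
  \<open>e\<close> of the bidual is abstract, known only through Arens products. It can be evaluated
  on right translates \<open>b \<mapsto> \<phi> (b a)\<close>, where it gives
  \<open>\<phi> a\<close>; so the limit functional is translated by \<open>a\<close> before
  \<open>q\<close>, \<open>e - q\<close> and \<open>e\<close> are compared on it. The unit of
  \<open>N\<close> cannot serve as \<open>a\<close>: for \<open>1 \<le> k \<le> n\<close> the block
  \<open>u_mat n k\<close> has zero diagonal, hence stays at distance at least 1 from the identity.
  A flat coefficient sequence is almost unchanged by small shifts of the index, and it keeps its
  mean away from zero.\<close>

section \<open>Generalized limits\<close>

text \<open>The filter comes from a cluster point of the evaluations \<open>x \<mapsto> x n\<close>, which lie in a product of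
  compact sets.\<close>

lemma generalized_limit_filter:
  obtains G :: "nat filter" where "G \<noteq> bot" "G \<le> sequentially"
    "\<And>x::nat \<Rightarrow> 'a::{real_normed_vector,heine_borel}. Bseq x \<Longrightarrow> \<exists>l. (x \<longlongrightarrow> l) G"
proof -
  \<comment> \<open>The coordinates are indexed by all sequences. Sending the unbounded ones to
    \<open>0\<close> makes every factor \<open>S x\<close> compact, so Tychonoff applies to the full
    product.\<close>
  define f :: "nat \<Rightarrow> (nat \<Rightarrow> 'a) \<Rightarrow> 'a" where "f n x = (if Bseq x then x n else 0)" for n x
  define S where "S x = closure (range (\<lambda>n. f n x))" for x
  have "compact (S x)" for x
  proof -
    have "bounded (range (\<lambda>n. f n x))"
      by (cases "Bseq x") (auto simp: f_def Bseq_eq_bounded)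
    then show ?thesis unfolding S_def by (simp add: compact_closure)
  qed
  then have "compactin (product_topology (\<lambda>_. euclidean) UNIV) (PiE UNIV S)"
    by (simp add: compactin_PiE)
  then have comp: "compact (PiE UNIV S)"
    by (simp add: euclidean_product_topology)
  have "f n \<in> PiE UNIV S" for n
    using closure_subset unfolding S_def by fastforce
  then have "eventually (\<lambda>\<psi>. \<psi> \<in> PiE UNIV S) (filtermap f sequentially)"
    by (simp add: eventually_filtermap)
  moreover have "filtermap f sequentially \<noteq> bot"
    by (simp add: filtermap_bot_iff)
  ultimately obtain \<phi> where \<phi>: "inf (nhds \<phi>) (filtermap f sequentially) \<noteq> bot"
    using comp unfolding compact_filter by blast
  \<comment> \<open>The sets of \<open>G\<close> contain the indices of some tail at which the
    evaluation is near \<open>\<phi>\<close>. Every coordinate of \<open>f\<close> converges along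
    such a filter, and it is proper because \<open>\<phi>\<close> is a cluster point.\<close>
  define G where "G = inf (filtercomap f (nhds \<phi>)) sequentially"
  have "G \<noteq> bot"
  proof
    assume "G = bot"
    then have "eventually (\<lambda>_. False) G" by simp
    then obtain P Q where P: "eventually P (nhds \<phi>)" and Q: "eventually Q sequentially"
      and PQ: "\<And>n. P (f n) \<Longrightarrow> Q n \<Longrightarrow> False"
      unfolding G_def eventually_inf eventually_filtercomap by blast
    have "eventually (\<lambda>\<psi>. \<exists>n. Q n \<and> \<psi> = f n) (filtermap f sequentially)"
      unfolding eventually_filtermap by (rule eventually_mono[OF Q]) auto
    then have "eventually (\<lambda>_. False) (inf (nhds \<phi>) (filtermap f sequentially))"
      unfolding eventually_inf using P PQ by blast
    then show False using \<phi> by (simp add: eventually_False)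
  qed
  moreover have "G \<le> sequentially" unfolding G_def by simp
  moreover have "\<exists>l. (x \<longlongrightarrow> l) G" if "Bseq x" for x :: "nat \<Rightarrow> 'a"
  proof -
    have "((\<lambda>\<psi>::(nat \<Rightarrow> 'a) \<Rightarrow> 'a. \<psi> x) \<longlongrightarrow> \<phi> x) (at \<phi>)"
      using continuous_on_product_coordinates[of x, where 'b = 'a] unfolding continuous_on_def by simp
    then have *: "((\<lambda>\<psi>::(nat \<Rightarrow> 'a) \<Rightarrow> 'a. \<psi> x) \<longlongrightarrow> \<phi> x) (nhds \<phi>)"
      using tendsto_at_iff_tendsto_nhds[of "\<lambda>\<psi>. \<psi> x" \<phi>] by simp
    have "filterlim f (nhds \<phi>) G"
      unfolding filterlim_iff_le_filtercomap G_def by simp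
    from filterlim_compose[OF * this] have "((\<lambda>n. f n x) \<longlongrightarrow> \<phi> x) G" .
    then show ?thesis using that by (auto simp: f_def)
  qed
  ultimately show ?thesis using that by blast
qed

section \<open>Normed algebras and their duals\<close>

lemma subalg_simps [simp]:
  "Carr (subalg B A) = A" "Plus (subalg B A) = Plus B" "Scale (subalg B A) = Scale B"
  "Norm (subalg B A) = Norm B" "Times (subalg B A) = Times B" "Star (subalg B A) = Star B"
  by (simp_all add: subalg_def)

lemma dual_simps [simp]:
  "Carr (dual X) = dual_carrier X"
  "Plus (dual X) = (\<lambda>\<phi> \<psi>. \<lambda>x \<in> Carr X. \<phi> x + \<psi> x)"
  "Scale (dual X) = (\<lambda>z \<phi>. \<lambda>x \<in> Carr X. z * \<phi> x)"
  by (simp_all add: dual_def)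

lemma bidual_simps [simp]:
  "Carr (bidual X) = dual_carrier (dual X)"
  "Plus (bidual X) = Plus (dual (dual X))"
  "Scale (bidual X) = Scale (dual (dual X))"
  "Times (bidual X) = arens X"
  "Star (bidual X) = (\<lambda>m. \<lambda>\<phi> \<in> dual_carrier X. cnj (m (dual_star X \<phi>)))"
  by (simp_all add: bidual_def)

text \<open>Apart from closure and nonemptiness the axioms are equations and inequalities over the
  carrier. They therefore pass to every nonempty subset closed under the operations, and one locale
  covers both \<open>M\<close> and \<open>A\<close>.\<close>

locale normed_algebra =
  fixes X :: "'a star_algebra"
  assumes plus_closed: "x \<in> Carr X \<Longrightarrow> y \<in> Carr X \<Longrightarrow> Plus X x y \<in> Carr X"
    and scale_closed: "x \<in> Carr X \<Longrightarrow> Scale X z x \<in> Carr X"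
    and times_closed: "x \<in> Carr X \<Longrightarrow> y \<in> Carr X \<Longrightarrow> Times X x y \<in> Carr X"
    and plus_assoc: "x \<in> Carr X \<Longrightarrow> y \<in> Carr X \<Longrightarrow> w \<in> Carr X \<Longrightarrow>
      Plus X (Plus X x y) w = Plus X x (Plus X y w)"
    and plus_commute: "x \<in> Carr X \<Longrightarrow> y \<in> Carr X \<Longrightarrow> Plus X x y = Plus X y x"
    and scale_plus: "x \<in> Carr X \<Longrightarrow> y \<in> Carr X \<Longrightarrow>
      Scale X z (Plus X x y) = Plus X (Scale X z x) (Scale X z y)"
    and scale_scale: "x \<in> Carr X \<Longrightarrow> Scale X z (Scale X z' x) = Scale X (z * z') x"
    and times_assoc: "x \<in> Carr X \<Longrightarrow> y \<in> Carr X \<Longrightarrow> w \<in> Carr X \<Longrightarrow>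
      Times X (Times X x y) w = Times X x (Times X y w)"
    and times_plus: "x \<in> Carr X \<Longrightarrow> y \<in> Carr X \<Longrightarrow> w \<in> Carr X \<Longrightarrow>
      Times X w (Plus X x y) = Plus X (Times X w x) (Times X w y)"
    and plus_times: "x \<in> Carr X \<Longrightarrow> y \<in> Carr X \<Longrightarrow> w \<in> Carr X \<Longrightarrow>
      Times X (Plus X x y) w = Plus X (Times X x w) (Times X y w)"
    and times_scale: "x \<in> Carr X \<Longrightarrow> y \<in> Carr X \<Longrightarrow>
      Times X x (Scale X z y) = Scale X z (Times X x y)"
    and scale_times: "x \<in> Carr X \<Longrightarrow> y \<in> Carr X \<Longrightarrow>
      Times X (Scale X z x) y = Scale X z (Times X x y)"
    and norm_nonneg: "x \<in> Carr X \<Longrightarrow> 0 \<le> Norm X x"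
    and norm_plus: "x \<in> Carr X \<Longrightarrow> y \<in> Carr X \<Longrightarrow> Norm X (Plus X x y) \<le> Norm X x + Norm X y"
    and norm_scale: "x \<in> Carr X \<Longrightarrow> Norm X (Scale X z x) \<le> cmod z * Norm X x"
    and norm_times: "x \<in> Carr X \<Longrightarrow> y \<in> Carr X \<Longrightarrow> Norm X (Times X x y) \<le> Norm X x * Norm X y"
    and carr_nonempty: "Carr X \<noteq> {}"
begin

text \<open>The dual norm is a real \<open>SUP\<close> over this ball, which says nothing on the
  empty set; scaling any element by \<open>0\<close> supplies a point.\<close>

lemma unit_ball_nonempty: "{x \<in> Carr X. Norm X x \<le> 1} \<noteq> {}"
proof -
  obtain x where "x \<in> Carr X" using carr_nonempty by blast
  then have "Scale X 0 x \<in> Carr X" "Norm X (Scale X 0 x) \<le> 1"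
    using scale_closed norm_scale[of x 0] by auto
  then show ?thesis by blast
qed

lemma dualI:
  assumes "\<phi> \<in> extensional (Carr X)"
    and "\<And>x y. x \<in> Carr X \<Longrightarrow> y \<in> Carr X \<Longrightarrow> \<phi> (Plus X x y) = \<phi> x + \<phi> y"
    and "\<And>z x. x \<in> Carr X \<Longrightarrow> \<phi> (Scale X z x) = z * \<phi> x"
    and "\<And>x. x \<in> Carr X \<Longrightarrow> cmod (\<phi> x) \<le> K * Norm X x"
  shows "\<phi> \<in> dual_carrier X"
  using assms unfolding dual_carrier_def by blast

lemma dual_plus: "\<phi> \<in> dual_carrier X \<Longrightarrow> x \<in> Carr X \<Longrightarrow> y \<in> Carr X \<Longrightarrow> \<phi> (Plus X x y) = \<phi> x + \<phi> y"
  and dual_scale: "\<phi> \<in> dual_carrier X \<Longrightarrow> x \<in> Carr X \<Longrightarrow> \<phi> (Scale X z x) = z * \<phi> x"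
  unfolding dual_carrier_def by auto

lemma dual_plus_closed:
  assumes "\<phi> \<in> dual_carrier X" "\<psi> \<in> dual_carrier X"
  shows "(\<lambda>x \<in> Carr X. \<phi> x + \<psi> x) \<in> dual_carrier X"
proof -
  obtain K L where "\<And>x. x \<in> Carr X \<Longrightarrow> cmod (\<phi> x) \<le> K * Norm X x"
    "\<And>x. x \<in> Carr X \<Longrightarrow> cmod (\<psi> x) \<le> L * Norm X x"
    using assms unfolding dual_carrier_def by blast
  then have "cmod (\<phi> x + \<psi> x) \<le> (K + L) * Norm X x" if "x \<in> Carr X" for x
    using that by (smt (verit) distrib_right norm_triangle_ineq)
  then show ?thesis
    using assms by (intro dualI[where K = "K + L"])
      (auto simp: dual_plus dual_scale plus_closed scale_closed algebra_simps)
qed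

lemma dual_scale_closed:
  assumes "\<phi> \<in> dual_carrier X"
  shows "(\<lambda>x \<in> Carr X. z * \<phi> x) \<in> dual_carrier X"
proof -
  obtain K where "\<And>x. x \<in> Carr X \<Longrightarrow> cmod (\<phi> x) \<le> K * Norm X x"
    using assms unfolding dual_carrier_def by blast
  then have "cmod (z * \<phi> x) \<le> cmod z * K * Norm X x" if "x \<in> Carr X" for x
    using that by (simp add: norm_mult mult.assoc mult_left_mono)
  then show ?thesis
    using assms by (intro dualI[where K = "cmod z * K"])
      (auto simp: dual_plus dual_scale plus_closed scale_closed algebra_simps)
qed

text \<open>The constant in \<open>dual_carrier\<close> may be negative, which would block
  multiplying inequalities by it; since the norm is nonnegative, it can be truncated at
  \<open>0\<close>.\<close>

lemma dual_bound:
  assumes "\<phi> \<in> dual_carrier X"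
  obtains K where "K \<ge> 0" "\<And>x. x \<in> Carr X \<Longrightarrow> cmod (\<phi> x) \<le> K * Norm X x"
proof -
  obtain K where K: "\<And>x. x \<in> Carr X \<Longrightarrow> cmod (\<phi> x) \<le> K * Norm X x"
    using assms unfolding dual_carrier_def by blast
  have "cmod (\<phi> x) \<le> max 0 K * Norm X x" if "x \<in> Carr X" for x
    using K[OF that] mult_right_mono[OF max.cobounded2[of K 0] norm_nonneg[OF that]] by linarith
  then show ?thesis using that[of "max 0 K"] by simp
qed

lemma dual_bdd_above:
  assumes "\<phi> \<in> dual_carrier X"
  shows "bdd_above ((\<lambda>x. cmod (\<phi> x)) ` {x \<in> Carr X. Norm X x \<le> 1})"
proof -
  obtain K where K: "K \<ge> 0" "\<And>x. x \<in> Carr X \<Longrightarrow> cmod (\<phi> x) \<le> K * Norm X x"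
    using dual_bound[OF assms] by blast
  have "cmod (\<phi> x) \<le> K" if "x \<in> Carr X" "Norm X x \<le> 1" for x
    using K(2)[OF that(1)] mult_left_mono[OF that(2) K(1)] by simp
  then show ?thesis by (intro bdd_aboveI[of _ K]) auto
qed

lemma le_dual_norm:
  assumes "\<phi> \<in> dual_carrier X" "x \<in> Carr X" "Norm X x \<le> 1"
  shows "cmod (\<phi> x) \<le> Norm (dual X) \<phi>"
  unfolding dual_def using dual_bdd_above[OF assms(1)] assms(2,3) by (auto intro: cSUP_upper)

lemma dual_norm_le:
  assumes "\<And>x. x \<in> Carr X \<Longrightarrow> Norm X x \<le> 1 \<Longrightarrow> cmod (\<phi> x) \<le> K"
  shows "Norm (dual X) \<phi> \<le> K"
  unfolding dual_def using unit_ball_nonempty assms by (auto intro!: cSUP_least)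

lemma dual_norm_nonneg: "\<phi> \<in> dual_carrier X \<Longrightarrow> 0 \<le> Norm (dual X) \<phi>"
  using unit_ball_nonempty le_dual_norm norm_ge_zero order_trans by (metis (mono_tags, lifting) empty_Collect_eq)

lemma dual_norm_ineq:
  assumes "\<phi> \<in> dual_carrier X" "x \<in> Carr X"
  shows "cmod (\<phi> x) \<le> Norm X x * Norm (dual X) \<phi>"
proof (cases "Norm X x = 0")
  \<comment> \<open>Such an \<open>x\<close> cannot be normalized, but boundedness of
    \<open>\<phi>\<close> already forces \<open>\<phi> x = 0\<close>.\<close>
  case True
  obtain K where "cmod (\<phi> x) \<le> K * Norm X x" using dual_bound[OF assms(1)] assms(2) by metis
  with True show ?thesis by simp
next
  case False
  define z where "z = complex_of_real (1 / Norm X x)"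
  have pos: "Norm X x > 0" using False norm_nonneg[OF assms(2)] by simp
  then have z: "cmod z * Norm X x = 1" by (simp add: z_def norm_divide)
  have "Norm X (Scale X z x) \<le> 1" using norm_scale[OF assms(2), of z] z by simp
  then have "cmod (\<phi> (Scale X z x)) \<le> Norm (dual X) \<phi>"
    using le_dual_norm assms scale_closed by blast
  then have "cmod z * cmod (\<phi> x) \<le> Norm (dual X) \<phi>"
    using dual_scale[OF assms] by (simp add: norm_mult)
  then have "Norm X x * (cmod z * cmod (\<phi> x)) \<le> Norm X x * Norm (dual X) \<phi>"
    using pos by simp
  moreover have "Norm X x * (cmod z * cmod (\<phi> x)) = cmod (\<phi> x)"
    using z by (metis mult.commute mult.left_commute mult_1)
  ultimately show ?thesis by simp
qed

section \<open>Module actions and the canonical embedding\<close>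

lemma dual_act_in:
  assumes "\<phi> \<in> dual_carrier X" "a \<in> Carr X"
  shows "dual_act X \<phi> a \<in> dual_carrier X"
proof -
  obtain K where K: "K \<ge> 0" "\<And>x. x \<in> Carr X \<Longrightarrow> cmod (\<phi> x) \<le> K * Norm X x"
    using dual_bound[OF assms(1)] by blast
  show ?thesis
  proof (rule dualI[where K = "K * Norm X a"])
    fix x assume x: "x \<in> Carr X"
    have "cmod (\<phi> (Times X a x)) \<le> K * (Norm X a * Norm X x)"
      using K(2)[OF times_closed[OF assms(2) x]] mult_left_mono[OF norm_times[OF assms(2) x] K(1)]
      by simp
    then show "cmod (dual_act X \<phi> a x) \<le> K * Norm X a * Norm X x"
      using x by (simp add: dual_act_def mult.assoc)
  qed (use assms in \<open>auto simp: dual_act_def plus_closed times_plus scale_closed times_scale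
        dual_plus dual_scale times_closed\<close>)
qed

lemma dual_act_plus:
  assumes "\<phi> \<in> dual_carrier X" "a \<in> Carr X" "b \<in> Carr X"
  shows "dual_act X \<phi> (Plus X a b) = Plus (dual X) (dual_act X \<phi> a) (dual_act X \<phi> b)"
  using assms by (auto simp: dual_act_def fun_eq_iff plus_times dual_plus times_closed)

lemma dual_act_scale:
  assumes "\<phi> \<in> dual_carrier X" "a \<in> Carr X"
  shows "dual_act X \<phi> (Scale X z a) = Scale (dual X) z (dual_act X \<phi> a)"
  using assms by (auto simp: dual_act_def fun_eq_iff scale_times dual_scale times_closed)

lemma dual_act_norm:
  assumes "\<phi> \<in> dual_carrier X"
  obtains K where "K \<ge> 0" "\<And>a. a \<in> Carr X \<Longrightarrow> Norm (dual X) (dual_act X \<phi> a) \<le> K * Norm X a"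
proof -
  obtain K where K: "K \<ge> 0" "\<And>x. x \<in> Carr X \<Longrightarrow> cmod (\<phi> x) \<le> K * Norm X x"
    using dual_bound[OF assms(1)] by blast
  have "cmod (dual_act X \<phi> a x) \<le> K * Norm X a"
    if a: "a \<in> Carr X" and x: "x \<in> Carr X" "Norm X x \<le> 1" for a x
  proof -
    have "cmod (\<phi> (Times X a x)) \<le> K * Norm X (Times X a x)"
      using K(2) times_closed a x by blast
    also have "\<dots> \<le> K * (Norm X a * 1)"
      using norm_times[OF a x(1)] mult_left_mono[OF x(2) norm_nonneg[OF a]] K(1)
      by (intro mult_left_mono) auto
    finally show ?thesis using x by (simp add: dual_act_def)
  qed
  then show ?thesis using that[OF K(1)] dual_norm_le by blast
qed

text \<open>The map from \<open>a\<close> to \<open>dual_act X \<phi> a\<close> is linear and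
  bounded into the dual, and \<open>n\<close> is composed with it. This keeps the Arens product
  inside the domain of its left factor.\<close>

lemma bidual_act_in:
  assumes "n \<in> dual_carrier (dual X)" "\<phi> \<in> dual_carrier X"
  shows "bidual_act X n \<phi> \<in> dual_carrier X"
proof -
  obtain K where K: "K \<ge> 0" "\<And>a. a \<in> Carr X \<Longrightarrow> Norm (dual X) (dual_act X \<phi> a) \<le> K * Norm X a"
    using dual_act_norm[OF assms(2)] by blast
  have n: "n (Plus (dual X) \<psi> \<psi>') = n \<psi> + n \<psi>'" "n (Scale (dual X) z \<psi>) = z * n \<psi>"
    if "\<psi> \<in> dual_carrier X" "\<psi>' \<in> dual_carrier X" for \<psi> \<psi>' z
    using assms(1) that unfolding dual_carrier_def[of "dual X"] by auto
  have "\<exists>C. \<forall>\<psi> \<in> dual_carrier X. cmod (n \<psi>) \<le> C * Norm (dual X) \<psi>"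
    using assms(1) unfolding dual_carrier_def[of "dual X"] by simp
  then obtain C' where C': "\<And>\<psi>. \<psi> \<in> dual_carrier X \<Longrightarrow> cmod (n \<psi>) \<le> C' * Norm (dual X) \<psi>"
    by blast
  define C where "C = max 0 C'"
  have C: "C \<ge> 0" by (simp add: C_def)
  have C2: "cmod (n \<psi>) \<le> C * Norm (dual X) \<psi>" if "\<psi> \<in> dual_carrier X" for \<psi>
    using C'[OF that] mult_right_mono[of C' C, OF _ dual_norm_nonneg[OF that]] by (auto simp: C_def)
  show ?thesis
  proof (rule dualI[where K = "C * K"])
    fix a assume a: "a \<in> Carr X"
    have "cmod (n (dual_act X \<phi> a)) \<le> C * Norm (dual X) (dual_act X \<phi> a)"
      by (rule C2[OF dual_act_in[OF assms(2) a]])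
    also have "\<dots> \<le> C * (K * Norm X a)" using K(2)[OF a] C by (rule mult_left_mono)
    finally show "cmod (bidual_act X n \<phi> a) \<le> C * K * Norm X a"
      using a by (simp add: bidual_act_def mult.assoc)
  qed (use assms in \<open>auto simp: bidual_act_def plus_closed scale_closed dual_act_plus
        dual_act_scale dual_act_in n simp del: dual_simps\<close>)
qed

lemma canon_in:
  assumes "x \<in> Carr X"
  shows "canon X x \<in> dual_carrier (dual X)"
  unfolding dual_carrier_def[of "dual X"]
proof (intro CollectI conjI ballI allI exI[where x = "Norm X x"])
  show "canon X x \<in> extensional (Carr (dual X))" by (simp add: canon_def)
next
  fix \<phi> assume "\<phi> \<in> Carr (dual X)"
  then show "cmod (canon X x \<phi>) \<le> Norm X x * Norm (dual X) \<phi>"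
    using dual_norm_ineq assms by (simp add: canon_def)
next
  fix \<phi> \<psi> assume *: "\<phi> \<in> Carr (dual X)" "\<psi> \<in> Carr (dual X)"
  then have "Plus (dual X) \<phi> \<psi> \<in> Carr (dual X)"
    using dual_plus_closed by simp
  with * assms show "canon X x (Plus (dual X) \<phi> \<psi>) = canon X x \<phi> + canon X x \<psi>"
    by (simp add: canon_def)
next
  fix z \<phi> assume *: "\<phi> \<in> Carr (dual X)"
  then have "Scale (dual X) z \<phi> \<in> Carr (dual X)"
    using dual_scale_closed by simp
  with * assms show "canon X x (Scale (dual X) z \<phi>) = z * canon X x \<phi>"
    by (simp add: canon_def)
qed

section \<open>Subalgebras and approximately fixed elements\<close>

lemma plus_left_commute:
  assumes "x \<in> Carr X" "y \<in> Carr X" "w \<in> Carr X"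
  shows "Plus X x (Plus X y w) = Plus X y (Plus X x w)"
  using assms by (metis plus_assoc plus_commute)

lemma normed_algebra_subalg:
  assumes "S \<subseteq> Carr X" "S \<noteq> {}"
    and "\<And>x y. x \<in> S \<Longrightarrow> y \<in> S \<Longrightarrow> Plus X x y \<in> S"
    and "\<And>z x. x \<in> S \<Longrightarrow> Scale X z x \<in> S"
    and "\<And>x y. x \<in> S \<Longrightarrow> y \<in> S \<Longrightarrow> Times X x y \<in> S"
  shows "normed_algebra (subalg X S)"
proof -
  have sub: "x \<in> Carr X" if "x \<in> S" for x using that assms(1) by blast
  show ?thesis
    using assms(2-5) by unfold_locales
      (simp_all add: sub plus_assoc plus_commute plus_left_commute scale_plus scale_scale times_assoc times_plus plus_times
        times_scale scale_times norm_nonneg norm_plus norm_scale norm_times)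
qed

lemma minus_closed: "x \<in> Carr X \<Longrightarrow> y \<in> Carr X \<Longrightarrow> Minus X x y \<in> Carr X"
  by (simp add: Minus_def plus_closed scale_closed)

lemma minus_plus_plus:
  assumes "x \<in> Carr X" "y \<in> Carr X" "x' \<in> Carr X" "y' \<in> Carr X"
  shows "Minus X (Plus X x y) (Plus X x' y') = Plus X (Minus X x x') (Minus X y y')"
  using assms by (simp add: Minus_def scale_plus plus_assoc plus_closed scale_closed plus_left_commute)

lemma minus_scale_scale:
  assumes "x \<in> Carr X" "y \<in> Carr X"
  shows "Minus X (Scale X z x) (Scale X z y) = Scale X z (Minus X x y)"
  using assms by (simp add: Minus_def scale_plus scale_scale scale_closed mult.commute)

lemma times_minus:
  assumes "x \<in> Carr X" "y \<in> Carr X" "w \<in> Carr X"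
  shows "Times X w (Minus X x y) = Minus X (Times X w x) (Times X w y)"
  using assms by (simp add: Minus_def times_plus times_scale scale_closed)

lemma minus_times:
  assumes "x \<in> Carr X" "y \<in> Carr X" "w \<in> Carr X"
  shows "Times X (Minus X x y) w = Minus X (Times X x w) (Times X y w)"
  using assms by (simp add: Minus_def plus_times scale_times scale_closed)

text \<open>For products, \<open>(xy)u - xy = x(yu - y)\<close> and
  \<open>u(xy) - xy = (ux - x)y\<close>, so each one-sided defect is a fixed element times a defect
  of a single factor. Sums and scalar multiples follow from subadditivity of the norm. With
  \<open>S = N\<close> and the given approximate identity this makes \<open>A\<close> an
  algebra.\<close>

lemma normed_algebra_approximately_fixed:
  fixes u :: "nat \<Rightarrow> 'a"
  defines "d \<equiv> \<lambda>a k. Norm X (Minus X (Times X a (u k)) a) + Norm X (Minus X (Times X (u k) a) a)"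
  assumes S: "S \<subseteq> Carr X"
    and S_plus: "\<And>x y. x \<in> S \<Longrightarrow> y \<in> S \<Longrightarrow> Plus X x y \<in> S"
    and S_scale: "\<And>z x. x \<in> S \<Longrightarrow> Scale X z x \<in> S"
    and S_times: "\<And>x y. x \<in> S \<Longrightarrow> y \<in> S \<Longrightarrow> Times X x y \<in> S"
    and u: "\<And>k. u k \<in> Carr X"
    and nonempty: "{a \<in> S. d a \<longlonglongrightarrow> 0} \<noteq> {}"
  shows "normed_algebra (subalg X {a \<in> S. d a \<longlonglongrightarrow> 0})"
proof (rule normed_algebra_subalg[OF _ nonempty])
  show "{a \<in> S. d a \<longlonglongrightarrow> 0} \<subseteq> Carr X" using S by blast
next
  have nn: "0 \<le> d a k" if "a \<in> Carr X" for a k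
    using that u by (simp add: d_def norm_nonneg minus_closed times_closed)
  have squeeze: "d a \<longlonglongrightarrow> 0" if "a \<in> Carr X" "\<And>k. d a k \<le> f k" "f \<longlonglongrightarrow> 0" for a f
    using that nn by (intro tendsto_sandwich[OF always_eventually always_eventually tendsto_const that(3)]) auto
  {
    fix x y assume "x \<in> {a \<in> S. d a \<longlonglongrightarrow> 0}" "y \<in> {a \<in> S. d a \<longlonglongrightarrow> 0}"
    then have xS: "x \<in> S" and yS: "y \<in> S" and lim: "d x \<longlonglongrightarrow> 0" "d y \<longlonglongrightarrow> 0" by auto
    then have x: "x \<in> Carr X" and y: "y \<in> Carr X" using S by auto
    note cl = plus_closed times_closed minus_closed u x y
    have "d (Plus X x y) k \<le> d x k + d y k" for k
    proof -
      have "Norm X (Minus X (Times X (Plus X x y) (u k)) (Plus X x y)) \<le>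
          Norm X (Minus X (Times X x (u k)) x) + Norm X (Minus X (Times X y (u k)) y)"
        using norm_plus[of "Minus X (Times X x (u k)) x" "Minus X (Times X y (u k)) y"]
        by (simp add: plus_times minus_plus_plus cl)
      moreover have "Norm X (Minus X (Times X (u k) (Plus X x y)) (Plus X x y)) \<le>
          Norm X (Minus X (Times X (u k) x) x) + Norm X (Minus X (Times X (u k) y) y)"
        using norm_plus[of "Minus X (Times X (u k) x) x" "Minus X (Times X (u k) y) y"]
        by (simp add: times_plus minus_plus_plus cl)
      ultimately show ?thesis unfolding d_def by linarith
    qed
    moreover have "(\<lambda>k. d x k + d y k) \<longlonglongrightarrow> 0" using tendsto_add[OF lim] by simp
    ultimately have "d (Plus X x y) \<longlonglongrightarrow> 0" by (rule squeeze[rotated]) (simp add: cl)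
    then show "Plus X x y \<in> {a \<in> S. d a \<longlonglongrightarrow> 0}" using S_plus[OF xS yS] by simp
    have "d (Times X x y) k \<le> Norm X x * d y k + d x k * Norm X y" for k
    proof -
      have "Minus X (Times X (Times X x y) (u k)) (Times X x y) = Times X x (Minus X (Times X y (u k)) y)"
        by (simp add: times_assoc times_minus cl)
      then have "Norm X (Minus X (Times X (Times X x y) (u k)) (Times X x y)) \<le>
          Norm X x * Norm X (Minus X (Times X y (u k)) y)"
        by (simp add: norm_times cl)
      also have "\<dots> \<le> Norm X x * d y k"
        unfolding d_def by (intro mult_left_mono) (simp_all add: norm_nonneg cl)
      finally have 1: "Norm X (Minus X (Times X (Times X x y) (u k)) (Times X x y)) \<le> Norm X x * d y k" .
      have "Minus X (Times X (u k) (Times X x y)) (Times X x y) = Times X (Minus X (Times X (u k) x) x) y"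
        by (simp add: times_assoc minus_times cl)
      then have "Norm X (Minus X (Times X (u k) (Times X x y)) (Times X x y)) \<le>
          Norm X (Minus X (Times X (u k) x) x) * Norm X y"
        by (simp add: norm_times cl)
      also have "\<dots> \<le> d x k * Norm X y"
        unfolding d_def by (intro mult_right_mono) (simp_all add: norm_nonneg cl)
      finally show ?thesis using 1 by (simp add: d_def)
    qed
    moreover have "(\<lambda>k. Norm X x * d y k + d x k * Norm X y) \<longlonglongrightarrow> 0"
      using tendsto_add[OF tendsto_mult_right_zero[OF lim(2)] tendsto_mult_left_zero[OF lim(1)]] by simp
    ultimately have "d (Times X x y) \<longlonglongrightarrow> 0" by (rule squeeze[rotated]) (simp add: cl)
    then show "Times X x y \<in> {a \<in> S. d a \<longlonglongrightarrow> 0}" using S_times[OF xS yS] by simp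
  next
    fix z x assume "x \<in> {a \<in> S. d a \<longlonglongrightarrow> 0}"
    then have xS: "x \<in> S" and lim: "d x \<longlonglongrightarrow> 0" by auto
    then have x: "x \<in> Carr X" using S by auto
    note cl = scale_closed times_closed minus_closed u x
    have "d (Scale X z x) k \<le> cmod z * d x k" for k
      using norm_scale[of "Minus X (Times X x (u k)) x" z] norm_scale[of "Minus X (Times X (u k) x) x" z]
      by (simp add: d_def scale_times times_scale minus_scale_scale cl distrib_left)
    moreover have "(\<lambda>k. cmod z * d x k) \<longlonglongrightarrow> 0" using tendsto_mult_right_zero[OF lim] .
    ultimately have "d (Scale X z x) \<longlonglongrightarrow> 0" by (rule squeeze[rotated]) (simp add: cl)
    then show "Scale X z x \<in> {a \<in> S. d a \<longlonglongrightarrow> 0}" using S_scale[OF xS] by simp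
  }
qed

end

text \<open>An involution is asked of the ambient algebra alone. The subalgebra \<open>A\<close>
  need not be selfadjoint, so selfadjointness of its projections is tested in the bidual of
  \<open>B\<close>.\<close>

locale normed_star_algebra = normed_algebra +
  assumes star_closed: "x \<in> Carr X \<Longrightarrow> Star X x \<in> Carr X"
    and star_plus: "x \<in> Carr X \<Longrightarrow> y \<in> Carr X \<Longrightarrow> Star X (Plus X x y) = Plus X (Star X x) (Star X y)"
    and star_scale: "x \<in> Carr X \<Longrightarrow> Star X (Scale X z x) = Scale X (cnj z) (Star X x)"
    and norm_star: "x \<in> Carr X \<Longrightarrow> Norm X (Star X x) \<le> Norm X x"
begin

lemma dual_star_in:
  assumes "\<phi> \<in> dual_carrier X"
  shows "dual_star X \<phi> \<in> dual_carrier X"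
proof -
  obtain K where K: "K \<ge> 0" "\<And>x. x \<in> Carr X \<Longrightarrow> cmod (\<phi> x) \<le> K * Norm X x"
    using dual_bound[OF assms] by blast
  have "cmod (\<phi> (Star X x)) \<le> K * Norm X x" if "x \<in> Carr X" for x
    using K(2)[OF star_closed[OF that]] mult_left_mono[OF norm_star[OF that] K(1)] by simp
  then show ?thesis
    using assms by (intro dualI[where K = K])
      (auto simp: dual_star_def plus_closed scale_closed star_closed star_plus star_scale
        dual_plus dual_scale)
qed

end

section \<open>The limit of an increasing sequence of projections\<close>

text \<open>The rule with \<open>min\<close> says in one equation that the \<open>p m\<close> are
  commuting idempotents that increase with \<open>m\<close>.\<close>

locale approximate_projections =
  B: normed_star_algebra B + A: normed_algebra "subalg B A"
  for B :: "'a star_algebra" and A :: "'a set" +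
  fixes p :: "nat \<Rightarrow> 'a"
  assumes sub: "A \<subseteq> Carr B"
    and p_in: "p m \<in> A"
    and norm_p: "Norm B (p m) \<le> 1"
    and star_p: "Star B (p m) = p m"
    and p_mult: "Times B (p m) (p k) = p (min m k)"
begin

abbreviation "A' \<equiv> dual_carrier (subalg B A)"

lemma dual_p_bound:
  assumes "\<phi> \<in> A'"
  shows "cmod (\<phi> (p m)) \<le> Norm (dual (subalg B A)) \<phi>"
  using A.le_dual_norm[OF assms] p_in norm_p by simp

lemma restrict_in: "\<phi> \<in> dual_carrier B \<Longrightarrow> restrict \<phi> A \<in> A'"
  using sub A.plus_closed A.scale_closed unfolding dual_carrier_def
  by (auto simp: subset_iff) blast

end

text \<open>On bounded scalar sequences \<open>G\<close> acts like a free ultrafilter. Limits along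
  it, taken functional by functional, take the place of weak* compactness of the unit ball of the
  bidual.\<close>

locale open_limit = approximate_projections B A p
  for B :: "'a star_algebra" and A :: "'a set" and p :: "nat \<Rightarrow> 'a" +
  fixes G :: "nat filter"
  assumes G_nontrivial: "G \<noteq> bot" and G_le: "G \<le> sequentially"
    and G_lim: "\<And>x::nat \<Rightarrow> complex. Bseq x \<Longrightarrow> \<exists>l. (x \<longlongrightarrow> l) G"
begin

definition q :: "('a \<Rightarrow> complex) \<Rightarrow> complex" where
  "q = (\<lambda>\<phi> \<in> A'. Lim G (\<lambda>m. \<phi> (p m)))"

lemma Lim_eqI: "(x \<longlongrightarrow> l) G \<Longrightarrow> Lim G x = l"
  using G_nontrivial by (simp add: tendsto_Lim)

lemma Lim_eventually: "eventually (\<lambda>n. x n = l) sequentially \<Longrightarrow> Lim G x = l"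
  using G_le by (intro Lim_eqI tendsto_eventually) (auto simp: le_filter_def)

lemma Lim_tendsto: "Bseq x \<Longrightarrow> (x \<longlongrightarrow> Lim G x) G" for x :: "nat \<Rightarrow> complex"
  using G_lim Lim_eqI by metis

lemma q_tendsto: "\<phi> \<in> A' \<Longrightarrow> ((\<lambda>m. \<phi> (p m)) \<longlongrightarrow> q \<phi>) G"
  using Lim_tendsto[OF BseqI'[OF dual_p_bound]] by (simp add: q_def)

lemma q_eqI: "\<phi> \<in> A' \<Longrightarrow> ((\<lambda>m. \<phi> (p m)) \<longlongrightarrow> l) G \<Longrightarrow> q \<phi> = l"
  using Lim_eqI by (simp add: q_def)

lemma q_in: "q \<in> dual_carrier (dual (subalg B A))"
  unfolding dual_carrier_def[of "dual _"]
proof (intro CollectI conjI ballI allI exI[where x = 1])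
  show "q \<in> extensional (Carr (dual (subalg B A)))" by (simp add: q_def)
next
  fix \<phi> assume "\<phi> \<in> Carr (dual (subalg B A))"
  then have \<phi>: "\<phi> \<in> A'" by simp
  show "cmod (q \<phi>) \<le> 1 * Norm (dual (subalg B A)) \<phi>"
    using tendsto_upperbound[OF tendsto_norm[OF q_tendsto[OF \<phi>]] _ G_nontrivial]
      dual_p_bound[OF \<phi>] by simp
next
  fix \<phi> \<psi> assume "\<phi> \<in> Carr (dual (subalg B A))" "\<psi> \<in> Carr (dual (subalg B A))"
  then have *: "\<phi> \<in> A'" "\<psi> \<in> A'" by simp_all
  then have "Plus (dual (subalg B A)) \<phi> \<psi> \<in> A'" using A.dual_plus_closed by simp
  then show "q (Plus (dual (subalg B A)) \<phi> \<psi>) = q \<phi> + q \<psi>"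
    using tendsto_add[OF q_tendsto[OF *(1)] q_tendsto[OF *(2)]] p_in by (intro q_eqI) simp_all
next
  fix z \<phi> assume "\<phi> \<in> Carr (dual (subalg B A))"
  then have *: "\<phi> \<in> A'" by simp
  then have "Scale (dual (subalg B A)) z \<phi> \<in> A'" using A.dual_scale_closed by simp
  then show "q (Scale (dual (subalg B A)) z \<phi>) = z * q \<phi>"
    using tendsto_mult[OF tendsto_const q_tendsto[OF *]] p_in by (intro q_eqI) simp_all
qed

text \<open>A canonical element acts on \<open>\<phi>\<close> by right translation. Hence, in
  \<open>arens_canon\<close>, multiplying \<open>m\<close> on the right by a canonical element means
  evaluating \<open>m\<close> at a translate; the products in the definition of an open projection
  are of this kind.\<close>

lemma dual_act_canon:
  assumes "\<phi> \<in> A'" "x \<in> A"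
  shows "bidual_act (subalg B A) (canon (subalg B A) x) \<phi> = (\<lambda>a \<in> A. \<phi> (Times B a x))"
  using A.dual_act_in[OF assms(1)] assms(2)
  by (auto simp: bidual_act_def canon_def dual_act_def fun_eq_iff)

lemma right_translate_in:
  assumes "\<phi> \<in> A'" "x \<in> A"
  shows "(\<lambda>a \<in> A. \<phi> (Times B a x)) \<in> A'"
  using A.bidual_act_in[OF A.canon_in assms(1), of x] dual_act_canon[OF assms] assms(2) by simp

lemma arens_canon:
  assumes "\<phi> \<in> A'" "x \<in> A"
  shows "arens (subalg B A) m (canon (subalg B A) x) \<phi> = m (\<lambda>a \<in> A. \<phi> (Times B a x))"
  using assms by (simp add: arens_def dual_act_canon)

text \<open>Since \<open>p k\<close> times \<open>p m\<close> is \<open>p m\<close> for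
  \<open>k \<ge> m\<close>, the sequence that defines \<open>q\<close> at the translate by
  \<open>p m\<close> is eventually constant.\<close>

lemma q_canon: "arens (subalg B A) q (canon (subalg B A) (p m)) = canon (subalg B A) (p m)"
proof
  fix \<phi>
  show "arens (subalg B A) q (canon (subalg B A) (p m)) \<phi> = canon (subalg B A) (p m) \<phi>"
  proof (cases "\<phi> \<in> A'")
    case True
    have "eventually (\<lambda>k. (\<lambda>a \<in> A. \<phi> (Times B a (p m))) (p k) = \<phi> (p m)) sequentially"
      using eventually_ge_at_top[of m] by eventually_elim (simp add: p_in p_mult min_def)
    then have "q (\<lambda>a \<in> A. \<phi> (Times B a (p m))) = \<phi> (p m)"
      using right_translate_in[OF True p_in] Lim_eventually by (simp add: q_def)
    then show ?thesis using True arens_canon[OF True p_in] by (simp add: canon_def)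
  qed (simp_all add: arens_def canon_def)
qed

section \<open>The image of \<open>q\<close> in the bidual of \<open>B\<close>\<close>

abbreviation "Q \<equiv> bidual_incl B A q"

lemma Q_eq: "\<phi> \<in> dual_carrier B \<Longrightarrow> Q \<phi> = q (restrict \<phi> A)"
  by (simp add: bidual_incl_def)

text \<open>The inclusion of biduals commutes with the limit: \<open>Q\<close> is the limit of the
  same \<open>p m\<close> tested on functionals of \<open>B\<close>, so idempotence and
  selfadjointness can be inherited from the \<open>p m\<close>.\<close>

lemma Q_tendsto: "\<phi> \<in> dual_carrier B \<Longrightarrow> ((\<lambda>m. \<phi> (p m)) \<longlongrightarrow> Q \<phi>) G"
  using q_tendsto[OF restrict_in] Q_eq p_in by simp

lemma Q_eqI: "\<phi> \<in> dual_carrier B \<Longrightarrow> ((\<lambda>m. \<phi> (p m)) \<longlongrightarrow> l) G \<Longrightarrow> Q \<phi> = l"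
  using q_eqI[OF restrict_in] Q_eq p_in by simp

lemma Q_in: "Q \<in> dual_carrier (dual B)"
  unfolding dual_carrier_def[of "dual _"]
proof (intro CollectI conjI ballI allI exI[where x = 1])
  show "Q \<in> extensional (Carr (dual B))" by (simp add: bidual_incl_def)
next
  fix \<phi> assume "\<phi> \<in> Carr (dual B)"
  then have \<phi>: "\<phi> \<in> dual_carrier B" by simp
  have "cmod (\<phi> (p m)) \<le> Norm (dual B) \<phi>" for m
    using B.le_dual_norm[OF \<phi>] p_in sub norm_p by blast
  then show "cmod (Q \<phi>) \<le> 1 * Norm (dual B) \<phi>"
    using tendsto_upperbound[OF tendsto_norm[OF Q_tendsto[OF \<phi>]] _ G_nontrivial] by simp
next
  fix \<phi> \<psi> assume "\<phi> \<in> Carr (dual B)" "\<psi> \<in> Carr (dual B)"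
  then have *: "\<phi> \<in> dual_carrier B" "\<psi> \<in> dual_carrier B" by simp_all
  then have "Plus (dual B) \<phi> \<psi> \<in> dual_carrier B" using B.dual_plus_closed by simp
  moreover have "p m \<in> Carr B" for m using p_in sub by blast
  ultimately show "Q (Plus (dual B) \<phi> \<psi>) = Q \<phi> + Q \<psi>"
    using tendsto_add[OF Q_tendsto[OF *(1)] Q_tendsto[OF *(2)]] by (intro Q_eqI) simp_all
next
  fix z \<phi> assume "\<phi> \<in> Carr (dual B)"
  then have *: "\<phi> \<in> dual_carrier B" by simp
  then have "Scale (dual B) z \<phi> \<in> dual_carrier B" using B.dual_scale_closed by simp
  moreover have "p m \<in> Carr B" for m using p_in sub by blast
  ultimately show "Q (Scale (dual B) z \<phi>) = z * Q \<phi>"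
    using tendsto_mult[OF tendsto_const Q_tendsto[OF *]] by (intro Q_eqI) simp_all
qed

text \<open>The product at \<open>\<phi>\<close> is the iterated limit over \<open>m\<close> of the
  limit over \<open>k\<close> of \<open>\<phi>\<close> at \<open>p m\<close> times
  \<open>p k\<close>. The inner sequence is constant for \<open>k \<ge> m\<close>, which leaves the
  limit of \<open>\<phi> (p m)\<close>.\<close>

lemma Q_idem: "arens B Q Q = Q"
proof
  fix \<phi>
  show "arens B Q Q \<phi> = Q \<phi>"
  proof (cases "\<phi> \<in> dual_carrier B")
    case True
    have pB: "p m \<in> Carr B" for m using p_in sub by blast
    have "bidual_act B Q \<phi> (p m) = \<phi> (p m)" for m
    proof -
      have "eventually (\<lambda>k. dual_act B \<phi> (p m) (p k) = \<phi> (p m)) sequentially"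
        using eventually_ge_at_top[of m] by eventually_elim (simp add: dual_act_def pB p_mult min_def)
      then have "((\<lambda>k. dual_act B \<phi> (p m) (p k)) \<longlongrightarrow> \<phi> (p m)) G"
        using G_le by (intro tendsto_eventually) (auto simp: le_filter_def)
      then have "Q (dual_act B \<phi> (p m)) = \<phi> (p m)"
        using Q_eqI B.dual_act_in[OF True pB] by blast
      then show ?thesis using pB by (simp add: bidual_act_def)
    qed
    then have "Q (bidual_act B Q \<phi>) = Q \<phi>"
      using Q_eqI[OF B.bidual_act_in[OF Q_in True]] Q_tendsto[OF True] by simp
    then show ?thesis using True by (simp add: arens_def)
  qed (simp_all add: arens_def bidual_incl_def)
qed

lemma Q_star: "Star (bidual B) Q = Q"
proof
  fix \<phi>
  show "Star (bidual B) Q \<phi> = Q \<phi>"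
  proof (cases "\<phi> \<in> dual_carrier B")
    case True
    have "dual_star B \<phi> (p m) = cnj (\<phi> (p m))" for m
      using p_in sub star_p by (auto simp: dual_star_def)
    then have "Q (dual_star B \<phi>) = cnj (Q \<phi>)"
      using Q_eqI[OF B.dual_star_in[OF True]] tendsto_cnj[OF Q_tendsto[OF True]] by simp
    then show ?thesis using True by simp
  qed (simp_all add: bidual_incl_def)
qed

lemma q_open: "open_projection B A q"
  unfolding open_projection_def projection_def is_proj_def
proof (intro conjI exI[where x = "filtermap p G"] ballI)
  show "q \<in> Carr (bidual (subalg B A))" using q_in by simp
  show "Q \<in> Carr (bidual B)" using Q_in by simp
  show "Times (bidual B) Q Q = Q" using Q_idem by simp
  show "Star (bidual B) Q = Q" by (rule Q_star)
  show "filtermap p G \<noteq> bot" using G_nontrivial by (simp add: filtermap_bot_iff)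
  show "\<forall>\<^sub>F x in filtermap p G. x \<in> A \<and>
      canon (subalg B A) x = Times (bidual (subalg B A)) q (canon (subalg B A) x)"
    using q_canon p_in by (simp add: eventually_filtermap)
  fix \<phi> assume "\<phi> \<in> Carr (dual (subalg B A))"
  then show "((\<lambda>x. \<phi> x) \<longlongrightarrow> q \<phi>) (filtermap p G)"
    using q_tendsto by (simp add: filterlim_filtermap)
qed

text \<open>Each \<open>\<tau> n\<close> reads one block, and the blocks of \<open>a\<close> do not
  fade out under these functionals. If \<open>e - q\<close> were open, then at the translated limit
  functional \<open>\<sigma>'\<close> both \<open>q\<close> and \<open>e - q\<close> would give
  zero, whereas \<open>e\<close> gives \<open>\<sigma> a\<close>, of modulus at least
  \<open>\<delta>\<close>.\<close>

lemma q_not_closed: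
  fixes \<tau> :: "nat \<Rightarrow> 'a \<Rightarrow> complex" and a :: 'a
  assumes \<tau>_plus: "\<And>n x y. x \<in> A \<Longrightarrow> y \<in> A \<Longrightarrow> \<tau> n (Plus B x y) = \<tau> n x + \<tau> n y"
    and \<tau>_scale: "\<And>n z x. x \<in> A \<Longrightarrow> \<tau> n (Scale B z x) = z * \<tau> n x"
    and \<tau>_bound: "\<And>n x. x \<in> A \<Longrightarrow> cmod (\<tau> n x) \<le> K * Norm B x"
    and \<tau>_p: "\<And>n m x. x \<in> A \<Longrightarrow> n \<le> m \<Longrightarrow> \<tau> n (Times B (p m) x) = \<tau> n x"
    and \<tau>_p_0: "\<And>n m x. x \<in> A \<Longrightarrow> m < n \<Longrightarrow> \<tau> n (Times B (p m) x) = 0"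
    and a: "a \<in> A"
    and \<tau>_a: "\<delta> > 0" "eventually (\<lambda>n. \<delta> \<le> cmod (\<tau> n a)) sequentially"
  shows "\<not> closed_projection B A q"
proof
  assume "closed_projection B A q"
  then obtain e where e: "is_identity (bidual (subalg B A)) e"
    and op: "open_projection B A (Minus (bidual (subalg B A)) e q)"
    unfolding closed_projection_def by blast
  define r where "r = Minus (bidual (subalg B A)) e q"
  have r: "r \<phi> = e \<phi> - q \<phi>" if "\<phi> \<in> A'" for \<phi>
    using that by (simp add: r_def Minus_def)
  obtain F where F: "F \<noteq> bot"
    and F_r: "\<forall>\<^sub>F x in F. x \<in> A \<and> canon (subalg B A) x = arens (subalg B A) r (canon (subalg B A) x)"
    and F_lim: "\<And>\<phi>. \<phi> \<in> A' \<Longrightarrow> ((\<lambda>x. \<phi> x) \<longlongrightarrow> r \<phi>) F"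
    using op unfolding open_projection_def r_def[symmetric] by auto
  \<comment> \<open>The left identity law at canonical elements is the only access to
    \<open>e\<close>: it determines \<open>e\<close> on right translates.\<close>
  have e_canon: "e (\<lambda>b \<in> A. \<phi> (Times B b x)) = \<phi> x" if "\<phi> \<in> A'" "x \<in> A" for \<phi> x
  proof -
    have "arens (subalg B A) e (canon (subalg B A) x) = canon (subalg B A) x"
      using e A.canon_in that(2) unfolding is_identity_def by simp
    then show ?thesis using arens_canon[OF that, of e] that by (simp add: canon_def)
  qed
  have \<tau>_in: "restrict (\<tau> n) A \<in> A'" for n
    using A.plus_closed A.scale_closed \<tau>_plus \<tau>_scale \<tau>_bound
    by (intro A.dualI[where K = K]) auto
  \<comment> \<open>This limit over the blocks ignores any finite number of them, so it kills
    \<open>p m\<close> times \<open>a\<close> for every \<open>m\<close>.\<close>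
  define \<sigma> where "\<sigma> = (\<lambda>x \<in> A. Lim G (\<lambda>n. \<tau> n x))"
  have \<sigma>_tendsto: "((\<lambda>n. \<tau> n x) \<longlongrightarrow> \<sigma> x) G" if "x \<in> A" for x
    using Lim_tendsto[OF BseqI'[OF \<tau>_bound[OF that]]] that by (simp add: \<sigma>_def)
  have \<sigma>_eqI: "\<sigma> x = l" if "x \<in> A" "((\<lambda>n. \<tau> n x) \<longlongrightarrow> l) G" for x l
    using Lim_eqI[OF that(2)] that(1) by (simp add: \<sigma>_def)
  have \<sigma>_in: "\<sigma> \<in> A'"
  proof (rule A.dualI[where K = K])
    fix x assume "x \<in> Carr (subalg B A)"
    then have x: "x \<in> A" by simp
    show "cmod (\<sigma> x) \<le> K * Norm (subalg B A) x"
      using tendsto_upperbound[OF tendsto_norm[OF \<sigma>_tendsto[OF x]] _ G_nontrivial]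
        \<tau>_bound[OF x] by simp
    fix z
    show "\<sigma> (Scale (subalg B A) z x) = z * \<sigma> x"
      using A.scale_closed x tendsto_mult[OF tendsto_const \<sigma>_tendsto[OF x]]
      by (intro \<sigma>_eqI) (simp_all add: \<tau>_scale)
  next
    fix x y assume "x \<in> Carr (subalg B A)" "y \<in> Carr (subalg B A)"
    then have x: "x \<in> A" and y: "y \<in> A" by simp_all
    show "\<sigma> (Plus (subalg B A) x y) = \<sigma> x + \<sigma> y"
      using A.plus_closed x y tendsto_add[OF \<sigma>_tendsto[OF x] \<sigma>_tendsto[OF y]]
      by (intro \<sigma>_eqI) (simp_all add: \<tau>_plus)
  qed (simp add: \<sigma>_def)
  \<comment> \<open>Translating by \<open>a\<close> brings the functional into the form on which
    \<open>e_canon\<close> evaluates \<open>e\<close>.\<close>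
  define \<sigma>' where "\<sigma>' = (\<lambda>b \<in> A. \<sigma> (Times B b a))"
  have \<sigma>'_in: "\<sigma>' \<in> A'" unfolding \<sigma>'_def by (rule right_translate_in[OF \<sigma>_in a])
  have tc: "Times B x y \<in> A" if "x \<in> A" "y \<in> A" for x y
    using A.times_closed that by simp
  have "q \<sigma>' = 0"
  proof (rule q_eqI[OF \<sigma>'_in])
    have "\<sigma> (Times B (p m) a) = 0" for m
    proof (rule \<sigma>_eqI[OF tc[OF p_in a]])
      have "eventually (\<lambda>n. \<tau> n (Times B (p m) a) = 0) sequentially"
        using eventually_gt_at_top[of m] by eventually_elim (simp add: \<tau>_p_0 a)
      then show "((\<lambda>n. \<tau> n (Times B (p m) a)) \<longlongrightarrow> 0) G"
        using G_le by (intro tendsto_eventually) (auto simp: le_filter_def)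
    qed
    then show "((\<lambda>m. \<sigma>' (p m)) \<longlongrightarrow> 0) G" by (simp add: \<sigma>'_def p_in)
  qed
  \<comment> \<open>The filter \<open>F\<close> converges weak* to \<open>r\<close> and eventually
    contains only \<open>x\<close> with \<open>x = r x\<close>, so it suffices that
    \<open>\<sigma>'\<close> vanishes at each such \<open>x\<close>.\<close>
  moreover have "r \<sigma>' = 0"
  proof -
    have "\<sigma>' x = 0" if x: "x \<in> A" "canon (subalg B A) x = arens (subalg B A) r (canon (subalg B A) x)" for x
    proof -
      \<comment> \<open>From \<open>x = (e - q) x\<close> and \<open>e x = x\<close> it follows that
        \<open>q x = 0\<close>, expressed here on functionals.\<close>
      have q0: "q (\<lambda>b \<in> A. \<phi> (Times B b x)) = 0" if \<phi>: "\<phi> \<in> A'" for \<phi>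
      proof -
        have "\<phi> x = r (\<lambda>b \<in> A. \<phi> (Times B b x))"
          using fun_cong[OF x(2), of \<phi>] arens_canon[OF \<phi> x(1), of r] \<phi> by (simp add: canon_def)
        then show ?thesis using r right_translate_in[OF \<phi> x(1)] e_canon[OF \<phi> x(1)] by simp
      qed
      \<comment> \<open>The relation \<open>q x = 0\<close> is tested on \<open>\<tau> n\<close>
        translated by \<open>a\<close>. Once \<open>m \<ge> n\<close>, left multiplication by
        \<open>p m\<close> is invisible to \<open>\<tau> n\<close>, so the limit that defines
        \<open>q\<close> is the value at \<open>x a\<close> itself.\<close>
      have "\<tau> n (Times B x a) = 0" for n
      proof -
        define \<psi> where "\<psi> = (\<lambda>b \<in> A. restrict (\<tau> n) A (Times B b a))"
        have \<psi>: "\<psi> \<in> A'" unfolding \<psi>_def by (rule right_translate_in[OF \<tau>_in a])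
        have "eventually (\<lambda>m. (\<lambda>b \<in> A. \<psi> (Times B b x)) (p m) = \<tau> n (Times B x a)) sequentially"
          using eventually_ge_at_top[of n]
        proof eventually_elim
          case (elim m)
          have "Times B (Times B (p m) x) a = Times B (p m) (Times B x a)"
            using A.times_assoc p_in x(1) a by simp
          then show ?case using elim p_in x(1) a tc by (simp add: \<psi>_def \<tau>_p)
        qed
        then have "q (\<lambda>b \<in> A. \<psi> (Times B b x)) = \<tau> n (Times B x a)"
          using right_translate_in[OF \<psi> x(1)] Lim_eventually by (simp add: q_def)
        with q0[OF \<psi>] show ?thesis by simp
      qed
      then show ?thesis using \<sigma>_eqI[OF tc[OF x(1) a], of 0] x(1) by (simp add: \<sigma>'_def)
    qed
    then have "eventually (\<lambda>x. \<sigma>' x = 0) F" using F_r by (auto elim: eventually_mono)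
    then have "((\<lambda>x. \<sigma>' x) \<longlongrightarrow> 0) F" by (rule tendsto_eventually)
    then show ?thesis using tendsto_unique[OF F F_lim[OF \<sigma>'_in]] by blast
  qed
  ultimately have "e \<sigma>' = 0" using r[OF \<sigma>'_in] by simp
  then have "\<sigma> a = 0" using e_canon[OF \<sigma>_in a] by (simp add: \<sigma>'_def)
  moreover have "eventually (\<lambda>n. \<delta> \<le> cmod (\<tau> n a)) G"
    using G_le \<tau>_a(2) by (auto simp: le_filter_def)
  then have "\<delta> \<le> cmod (\<sigma> a)"
    by (rule tendsto_lowerbound[OF tendsto_norm[OF \<sigma>_tendsto[OF a]] _ G_nontrivial])
  ultimately show False using \<tau>_a(1) by simp
qed

end

section \<open>The operator norm\<close>

lemma l2norm_nonneg: "0 \<le> l2norm v"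
  by (simp add: l2norm_def)

lemma l2norm_smult: "l2norm (z \<cdot>\<^sub>v v) = cmod z * l2norm v"
proof -
  have "l2norm (z \<cdot>\<^sub>v v) = L2_set (\<lambda>i. cmod z * cmod (v $ i)) {..<dim_vec v}"
    unfolding l2norm_def by (intro L2_set_cong) (auto simp: norm_mult)
  then show ?thesis by (simp add: l2norm_def L2_set_right_distrib)
qed

lemma l2norm_add:
  assumes "dim_vec v = dim_vec w"
  shows "l2norm (v + w) \<le> l2norm v + l2norm w"
proof -
  have "l2norm (v + w) \<le> L2_set (\<lambda>i. cmod (v $ i) + cmod (w $ i)) {..<dim_vec w}"
    unfolding l2norm_def by (auto intro!: L2_set_mono norm_triangle_ineq)
  also have "\<dots> \<le> l2norm v + l2norm w"
    unfolding l2norm_def assms by (rule L2_set_triangle_ineq)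
  finally show ?thesis .
qed

lemma l2norm_inner:
  assumes "dim_vec v = dim_vec w"
  shows "cmod (\<Sum>i<dim_vec v. v $ i * w $ i) \<le> l2norm v * l2norm w"
proof -
  have "cmod (\<Sum>i<dim_vec v. v $ i * w $ i) \<le> (\<Sum>i<dim_vec v. \<bar>cmod (v $ i)\<bar> * \<bar>cmod (w $ i)\<bar>)"
    by (rule order_trans[OF norm_sum]) (simp add: norm_mult)
  also have "\<dots> \<le> l2norm v * l2norm w"
    unfolding l2norm_def assms[symmetric] by (rule L2_set_mult_ineq)
  finally show ?thesis .
qed

lemma mult_mat_vec_index:
  assumes "i < dim_row X" "v \<in> carrier_vec (dim_col X)"
  shows "(X *\<^sub>v v) $ i = (\<Sum>j<dim_col X. X $$ (i, j) * v $ j)"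
  using assms by (simp add: scalar_prod_def lessThan_atLeast0)

text \<open>Schur's test with one bound for rows and columns. Splitting each weight as a product of
  two square roots, Cauchy-Schwarz uses up one factor \<open>\<beta>\<close> on the row sums; after
  the order of summation is exchanged, the column sums give the other.\<close>

lemma schur_test:
  assumes "v \<in> carrier_vec (dim_col X)" and "0 \<le> \<beta>"
    and row: "\<And>i. i < dim_row X \<Longrightarrow> (\<Sum>j<dim_col X. cmod (X $$ (i, j))) \<le> \<beta>"
    and col: "\<And>j. j < dim_col X \<Longrightarrow> (\<Sum>i<dim_row X. cmod (X $$ (i, j))) \<le> \<beta>"
  shows "l2norm (X *\<^sub>v v) \<le> \<beta> * l2norm v"
proof -
  let ?x = "\<lambda>i j. cmod (X $$ (i, j))" and ?v = "\<lambda>j. cmod (v $ j)"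
  have entry: "(cmod ((X *\<^sub>v v) $ i))\<^sup>2 \<le> \<beta> * (\<Sum>j<dim_col X. ?x i j * (?v j)\<^sup>2)" if i: "i < dim_row X" for i
  proof -
    have "cmod ((X *\<^sub>v v) $ i) \<le> (\<Sum>j<dim_col X. ?x i j * ?v j)"
      unfolding mult_mat_vec_index[OF i assms(1)]
      by (rule order_trans[OF norm_sum]) (simp add: norm_mult)
    also have "\<dots> = (\<Sum>j<dim_col X. \<bar>sqrt (?x i j)\<bar> * \<bar>sqrt (?x i j) * ?v j\<bar>)"
      by (simp add: abs_mult flip: mult.assoc)
    also have "\<dots> \<le> L2_set (\<lambda>j. sqrt (?x i j)) {..<dim_col X} * L2_set (\<lambda>j. sqrt (?x i j) * ?v j) {..<dim_col X}"
      by (rule L2_set_mult_ineq)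
    finally have "(cmod ((X *\<^sub>v v) $ i))\<^sup>2 \<le>
        (L2_set (\<lambda>j. sqrt (?x i j)) {..<dim_col X} * L2_set (\<lambda>j. sqrt (?x i j) * ?v j) {..<dim_col X})\<^sup>2"
      by (rule power_mono) simp
    also have "\<dots> = (\<Sum>j<dim_col X. ?x i j) * (\<Sum>j<dim_col X. ?x i j * (?v j)\<^sup>2)"
      by (simp add: L2_set_def power_mult_distrib sum_nonneg)
    also have "\<dots> \<le> \<beta> * (\<Sum>j<dim_col X. ?x i j * (?v j)\<^sup>2)"
      using row[OF i] by (intro mult_right_mono sum_nonneg) auto
    finally show ?thesis .
  qed
  have "(\<Sum>i<dim_row X. (cmod ((X *\<^sub>v v) $ i))\<^sup>2) \<le> (\<Sum>i<dim_row X. \<beta> * (\<Sum>j<dim_col X. ?x i j * (?v j)\<^sup>2))"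
    using entry by (intro sum_mono) simp
  also have "\<dots> = \<beta> * (\<Sum>i<dim_row X. \<Sum>j<dim_col X. ?x i j * (?v j)\<^sup>2)"
    by (simp add: sum_distrib_left)
  also have "\<dots> = \<beta> * (\<Sum>j<dim_col X. (\<Sum>i<dim_row X. ?x i j) * (?v j)\<^sup>2)"
    by (subst sum.swap) (simp add: sum_distrib_right)
  also have "\<dots> \<le> \<beta> * (\<Sum>j<dim_col X. \<beta> * (?v j)\<^sup>2)"
    using assms(2) col by (intro mult_left_mono sum_mono mult_right_mono) auto
  also have "\<dots> = \<beta>\<^sup>2 * (\<Sum>j<dim_col X. (?v j)\<^sup>2)"
    by (simp add: sum_distrib_left power2_eq_square mult.assoc)
  finally have "sqrt (\<Sum>i<dim_row X. (cmod ((X *\<^sub>v v) $ i))\<^sup>2) \<le> sqrt (\<beta>\<^sup>2 * (\<Sum>j<dim_col X. (?v j)\<^sup>2))"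
    by (rule real_sqrt_le_mono)
  then show ?thesis using assms(1,2) by (simp add: l2norm_def L2_set_def real_sqrt_mult)
qed

text \<open>The sum of all moduli dominates every row and column sum. This crude constant makes the
  supremum in \<open>opnorm\<close> one over a bounded set.\<close>

lemma mult_mat_vec_bound:
  obtains \<beta> where "0 \<le> \<beta>"
    "\<And>v. v \<in> carrier_vec (dim_col X) \<Longrightarrow> l2norm (X *\<^sub>v v) \<le> \<beta> * l2norm v"
proof -
  define \<beta> where "\<beta> = (\<Sum>i<dim_row X. \<Sum>j<dim_col X. cmod (X $$ (i, j)))"
  have row: "(\<Sum>j<dim_col X. cmod (X $$ (i, j))) \<le> \<beta>" if "i < dim_row X" for i
    unfolding \<beta>_def using that by (intro member_le_sum) (auto intro: sum_nonneg)
  have col: "(\<Sum>i<dim_row X. cmod (X $$ (i, j))) \<le> \<beta>" if "j < dim_col X" for j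
    unfolding \<beta>_def using that by (intro sum_mono member_le_sum) auto
  have "0 \<le> \<beta>" unfolding \<beta>_def by (intro sum_nonneg) auto
  then show ?thesis using that schur_test[OF _ _ row col] by blast
qed

lemma opnorm_bdd_above:
  "bdd_above ((\<lambda>v. l2norm (X *\<^sub>v v)) ` {v \<in> carrier_vec (dim_col X). l2norm v \<le> 1})"
proof -
  obtain \<beta> where \<beta>: "0 \<le> \<beta>" "\<And>v. v \<in> carrier_vec (dim_col X) \<Longrightarrow> l2norm (X *\<^sub>v v) \<le> \<beta> * l2norm v"
    using mult_mat_vec_bound[of X] by blast
  have "l2norm (X *\<^sub>v v) \<le> \<beta>" if "v \<in> carrier_vec (dim_col X)" "l2norm v \<le> 1" for v
    using \<beta>(2)[OF that(1)] mult_left_mono[OF that(2) \<beta>(1)] by simp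
  then show ?thesis by (intro bdd_aboveI[of _ \<beta>]) auto
qed

lemma l2norm_0: "l2norm (0\<^sub>v n) = 0"
  by (simp add: l2norm_def L2_set_0')

lemma opnorm_leI:
  assumes "0 \<le> K" "\<And>v. v \<in> carrier_vec (dim_col X) \<Longrightarrow> l2norm (X *\<^sub>v v) \<le> K * l2norm v"
  shows "opnorm X \<le> K"
  unfolding opnorm_def
proof (rule cSUP_least)
  have "0\<^sub>v (dim_col X) \<in> {v \<in> carrier_vec (dim_col X). l2norm v \<le> 1}" by (simp add: l2norm_0)
  then show "{v \<in> carrier_vec (dim_col X). l2norm v \<le> 1} \<noteq> {}" by blast
next
  fix v :: "complex Matrix.vec" assume "v \<in> {v \<in> carrier_vec (dim_col X). l2norm v \<le> 1}"
  then show "l2norm (X *\<^sub>v v) \<le> K"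
    using assms(2)[of v] mult_left_mono[of "l2norm v" 1 K] assms(1) by simp
qed

lemma opnorm_nonneg: "0 \<le> opnorm X"
  unfolding opnorm_def
  by (rule cSUP_upper2[OF opnorm_bdd_above, of "0\<^sub>v (dim_col X)"]) (simp_all add: l2norm_0 l2norm_nonneg)

lemma opnorm_ineq:
  assumes "v \<in> carrier_vec (dim_col X)"
  shows "l2norm (X *\<^sub>v v) \<le> opnorm X * l2norm v"
proof (cases "l2norm v = 0")
  case True
  obtain \<beta> where "l2norm (X *\<^sub>v v) \<le> \<beta> * l2norm v"
    using mult_mat_vec_bound[of X] assms by blast
  with True show ?thesis by simp
next
  case False
  define z where "z = complex_of_real (1 / l2norm v)"
  have pos: "l2norm v > 0" using False l2norm_nonneg[of v] by simp
  then have z: "cmod z = 1 / l2norm v" by (simp add: z_def norm_divide)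
  have "z \<cdot>\<^sub>v v \<in> carrier_vec (dim_col X)" "l2norm (z \<cdot>\<^sub>v v) \<le> 1"
    using assms z pos by (simp_all add: l2norm_smult)
  then have "l2norm (X *\<^sub>v (z \<cdot>\<^sub>v v)) \<le> opnorm X"
    unfolding opnorm_def by (intro cSUP_upper opnorm_bdd_above) simp
  moreover have "X *\<^sub>v (z \<cdot>\<^sub>v v) = z \<cdot>\<^sub>v (X *\<^sub>v v)"
    using mult_mat_vec[of X "dim_row X" "dim_col X" v z] assms by simp
  ultimately show ?thesis using pos z by (simp add: l2norm_smult field_simps)
qed

lemma opnorm_zero: "opnorm (0\<^sub>m m n) = 0"
proof (rule antisym[OF opnorm_leI opnorm_nonneg])
  fix v :: "complex Matrix.vec" assume "v \<in> carrier_vec (dim_col (0\<^sub>m m n :: complex mat))"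
  then have "0\<^sub>m m n *\<^sub>v v = 0\<^sub>v m" by (intro eq_vecI) (auto simp: scalar_prod_def)
  then show "l2norm (0\<^sub>m m n *\<^sub>v v) \<le> 0 * l2norm v" by (simp add: l2norm_0)
qed simp

lemma opnorm_one: "opnorm (1\<^sub>m n) \<le> 1"
  by (rule opnorm_leI) auto

lemma opnorm_add:
  assumes "X \<in> carrier_mat m n" "Y \<in> carrier_mat m n"
  shows "opnorm (X + Y) \<le> opnorm X + opnorm Y"
proof (rule opnorm_leI)
  fix v :: "complex Matrix.vec" assume "v \<in> carrier_vec (dim_col (X + Y))"
  then have v: "v \<in> carrier_vec n" using assms by simp
  have "l2norm ((X + Y) *\<^sub>v v) \<le> l2norm (X *\<^sub>v v) + l2norm (Y *\<^sub>v v)"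
    using l2norm_add[of "X *\<^sub>v v" "Y *\<^sub>v v"] assms add_mult_distrib_mat_vec[OF assms v] by simp
  also have "\<dots> \<le> (opnorm X + opnorm Y) * l2norm v"
    using opnorm_ineq[of v X] opnorm_ineq[of v Y] v assms by (simp add: distrib_right)
  finally show "l2norm ((X + Y) *\<^sub>v v) \<le> (opnorm X + opnorm Y) * l2norm v" .
qed (simp add: opnorm_nonneg)

lemma opnorm_smult: "opnorm (z \<cdot>\<^sub>m X) \<le> cmod z * opnorm X"
proof (rule opnorm_leI)
  fix v :: "complex Matrix.vec" assume "v \<in> carrier_vec (dim_col (z \<cdot>\<^sub>m X))"
  then have v: "v \<in> carrier_vec (dim_col X)" by simp
  have "(z \<cdot>\<^sub>m X) *\<^sub>v v = z \<cdot>\<^sub>v (X *\<^sub>v v)"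
    using v by (intro eq_vecI) auto
  then show "l2norm ((z \<cdot>\<^sub>m X) *\<^sub>v v) \<le> cmod z * opnorm X * l2norm v"
    using opnorm_ineq[OF v] by (simp add: l2norm_smult mult.assoc mult_left_mono)
qed (simp add: opnorm_nonneg)

lemma opnorm_mult:
  assumes "X \<in> carrier_mat m n" "Y \<in> carrier_mat n k"
  shows "opnorm (X * Y) \<le> opnorm X * opnorm Y"
proof (rule opnorm_leI)
  fix v :: "complex Matrix.vec" assume "v \<in> carrier_vec (dim_col (X * Y))"
  then have v: "v \<in> carrier_vec k" using assms by simp
  have "l2norm ((X * Y) *\<^sub>v v) = l2norm (X *\<^sub>v (Y *\<^sub>v v))" using assms v by simp
  also have "\<dots> \<le> opnorm X * l2norm (Y *\<^sub>v v)" using assms v by (intro opnorm_ineq) auto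
  also have "\<dots> \<le> opnorm X * (opnorm Y * l2norm v)"
    using assms v by (intro mult_left_mono opnorm_ineq opnorm_nonneg) auto
  finally show "l2norm ((X * Y) *\<^sub>v v) \<le> opnorm X * opnorm Y * l2norm v" by (simp add: mult.assoc)
qed (simp add: opnorm_nonneg)

lemma dim_mat_adjoint [simp]:
  "dim_row (mat_adjoint X) = dim_col X" "dim_col (mat_adjoint X) = dim_row X"
  by (simp_all add: mat_adjoint_def)

lemma mat_adjoint_index [simp]:
  "i < dim_col X \<Longrightarrow> j < dim_row X \<Longrightarrow> mat_adjoint X $$ (i, j) = cnj (X $$ (j, i))"
  for X :: "complex mat"
  by (simp add: mat_adjoint_def mat_of_rows_index)

text \<open>For \<open>w = X\<^sup>* v\<close> the square of the norm of \<open>w\<close> is the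
  inner product of \<open>v\<close> with \<open>X w\<close>, hence at most \<open>opnorm X\<close>
  times the norms of \<open>w\<close> and \<open>v\<close>; one norm of \<open>w\<close>
  cancels.\<close>

lemma opnorm_adjoint: "opnorm (mat_adjoint X) \<le> opnorm X"
proof (rule opnorm_leI)
  fix v :: "complex Matrix.vec" assume "v \<in> carrier_vec (dim_col (mat_adjoint X))"
  then have v: "v \<in> carrier_vec (dim_row X)" by simp
  define w where "w = mat_adjoint X *\<^sub>v v"
  have w: "w \<in> carrier_vec (dim_col X)" unfolding w_def by (rule carrier_vecI) simp
  have "complex_of_real ((l2norm w)\<^sup>2) = (\<Sum>i<dim_col X. complex_of_real ((cmod (w $ i))\<^sup>2))"
    using w by (simp add: l2norm_def L2_set_def sum_nonneg)
  also have "\<dots> = (\<Sum>i<dim_col X. cnj (w $ i) * w $ i)"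
    by (intro sum.cong refl) (simp only: complex_norm_square mult.commute)
  also have "\<dots> = (\<Sum>i<dim_col X. \<Sum>j<dim_row X. cnj (w $ i) * (cnj (X $$ (j, i)) * v $ j))"
  proof (intro sum.cong refl)
    fix i assume "i \<in> {..<dim_col X}"
    then have "w $ i = (\<Sum>j<dim_row X. cnj (X $$ (j, i)) * v $ j)"
      using mult_mat_vec_index[of i "mat_adjoint X" v] v by (simp add: w_def)
    then show "cnj (w $ i) * w $ i = (\<Sum>j<dim_row X. cnj (w $ i) * (cnj (X $$ (j, i)) * v $ j))"
      by (simp add: sum_distrib_left)
  qed
  also have "\<dots> = (\<Sum>j<dim_row X. cnj ((X *\<^sub>v w) $ j) * v $ j)"
    by (subst sum.swap) (auto intro!: sum.cong simp: mult_mat_vec_index[OF _ w] sum_distrib_left sum_distrib_right mult_ac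
        simp del: index_mult_mat_vec)
  \<comment> \<open>The estimate \<open>l2norm_inner\<close> is for the bilinear pairing, so the
    conjugation is absorbed into a vector of equal norm.\<close>
  also have "\<dots> = (\<Sum>j<dim_vec (map_vec cnj (X *\<^sub>v w)). map_vec cnj (X *\<^sub>v w) $ j * v $ j)" by simp
  finally have "complex_of_real ((l2norm w)\<^sup>2) = \<dots>" .
  then have "(l2norm w)\<^sup>2 \<le> l2norm (map_vec cnj (X *\<^sub>v w)) * l2norm v"
    using l2norm_inner[of "map_vec cnj (X *\<^sub>v w)" v] v
    by (metis abs_power2 carrier_vecD dim_mult_mat_vec index_map_vec(2) norm_of_real)
  also have "l2norm (map_vec cnj (X *\<^sub>v w)) = l2norm (X *\<^sub>v w)"
    by (simp add: l2norm_def cong: L2_set_cong_simp)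
  also have "l2norm (X *\<^sub>v w) * l2norm v \<le> opnorm X * l2norm w * l2norm v"
    by (intro mult_right_mono opnorm_ineq w l2norm_nonneg)
  finally have *: "l2norm w * l2norm w \<le> l2norm w * (opnorm X * l2norm v)"
    by (simp add: power2_eq_square mult_ac)
  show "l2norm (mat_adjoint X *\<^sub>v v) \<le> opnorm X * l2norm v"
  proof (cases "l2norm w = 0")
    case True
    then show ?thesis using opnorm_nonneg l2norm_nonneg by (simp add: w_def)
  next
    case False
    then show ?thesis using * l2norm_nonneg[of w] by (simp add: w_def)
  qed
qed (rule opnorm_nonneg)

section \<open>The algebra M\<close>

lemma M_alg_simps [simp]:
  "Plus M_alg = (\<lambda>x y. \<lambda>n \<in> {1..}. (fst (x n) + fst (y n), snd (x n) + snd (y n)))"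
  "Scale M_alg = (\<lambda>z x. \<lambda>n \<in> {1..}. (z \<cdot>\<^sub>m fst (x n), z \<cdot>\<^sub>m snd (x n)))"
  "Times M_alg = (\<lambda>x y. \<lambda>n \<in> {1..}. (fst (x n) * fst (y n), snd (x n) * snd (y n)))"
  "Star M_alg = (\<lambda>x. \<lambda>n \<in> {1..}. (mat_adjoint (fst (x n)), mat_adjoint (snd (x n))))"
  by (simp_all add: M_alg_def)

lemma M_algI:
  assumes "x \<in> extensional {1..}"
    and "\<And>n. n \<ge> 1 \<Longrightarrow> fst (x n) \<in> carrier_mat n n" "\<And>n. n \<ge> 1 \<Longrightarrow> snd (x n) \<in> carrier_mat n n"
    and "\<And>n. n \<ge> 1 \<Longrightarrow> opnorm (fst (x n)) \<le> K" "\<And>n. n \<ge> 1 \<Longrightarrow> opnorm (snd (x n)) \<le> K"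
  shows "x \<in> Carr M_alg"
proof -
  have "x n \<in> carrier_mat n n \<times> carrier_mat n n" if "n \<ge> 1" for n
    using assms(2,3)[OF that] by (simp add: mem_Times_iff)
  then show ?thesis using assms unfolding M_alg_def by (auto simp: PiE_iff intro!: exI[of _ K])
qed

lemma M_algD:
  assumes "x \<in> Carr M_alg"
  shows "x \<in> extensional {1..}"
    and "\<And>n. n \<ge> 1 \<Longrightarrow> fst (x n) \<in> carrier_mat n n" "\<And>n. n \<ge> 1 \<Longrightarrow> snd (x n) \<in> carrier_mat n n"
  using assms unfolding M_alg_def by (auto simp: PiE_iff mem_Times_iff)

lemma M_alg_eqI:
  assumes "x \<in> extensional {1..}" "y \<in> extensional {1..}"
    and "\<And>n. n \<ge> 1 \<Longrightarrow> fst (x n) = fst (y n)" "\<And>n. n \<ge> 1 \<Longrightarrow> snd (x n) = snd (y n)"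
  shows "x = y"
  using assms by (intro extensionalityI[of x "{1..}" y]) (auto intro: prod_eqI)

lemma M_alg_norm_le:
  assumes "\<And>n. n \<ge> 1 \<Longrightarrow> opnorm (fst (x n)) \<le> K" "\<And>n. n \<ge> 1 \<Longrightarrow> opnorm (snd (x n)) \<le> K"
  shows "Norm M_alg x \<le> K"
  unfolding M_alg_def using assms by (auto intro!: cSUP_least)

text \<open>A real \<open>SUP\<close> dominates its members when the family is bounded, and
  membership in \<open>M\<close> supplies the bound.\<close>

lemma M_alg_norm_ge:
  assumes "x \<in> Carr M_alg" "n \<ge> 1"
  shows "opnorm (fst (x n)) \<le> Norm M_alg x" "opnorm (snd (x n)) \<le> Norm M_alg x"
proof -
  obtain K where "\<forall>n\<ge>1. max (opnorm (fst (x n))) (opnorm (snd (x n))) \<le> K"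
    using assms(1) unfolding M_alg_def by auto
  then have "bdd_above ((\<lambda>n. max (opnorm (fst (x n))) (opnorm (snd (x n)))) ` {1..})"
    by (intro bdd_aboveI[of _ K]) auto
  moreover have "Norm M_alg x = (SUP n \<in> {1..}. max (opnorm (fst (x n))) (opnorm (snd (x n))))"
    by (simp add: M_alg_def)
  ultimately have "max (opnorm (fst (x n))) (opnorm (snd (x n))) \<le> Norm M_alg x"
    using cSUP_upper[of n "{1..}"] assms(2) by (metis (no_types, lifting) atLeast_iff)
  then show "opnorm (fst (x n)) \<le> Norm M_alg x" "opnorm (snd (x n)) \<le> Norm M_alg x" by simp_all
qed

lemma mat_adjoint_add:
  fixes X Y :: "complex mat"
  assumes "X \<in> carrier_mat m n" "Y \<in> carrier_mat m n"
  shows "mat_adjoint (X + Y) = mat_adjoint X + mat_adjoint Y"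
  using assms by (intro eq_matI) auto

lemma mat_adjoint_smult: "mat_adjoint (z \<cdot>\<^sub>m X) = cnj z \<cdot>\<^sub>m mat_adjoint X" for X :: "complex mat"
  by (intro eq_matI) auto

lemma mat_adjoint_carrier: "X \<in> carrier_mat m n \<Longrightarrow> mat_adjoint X \<in> carrier_mat n m"
  for X :: "complex mat"
  by auto

lemma M_alg_norm_nonneg:
  assumes "x \<in> Carr M_alg"
  shows "0 \<le> Norm M_alg x"
  using M_alg_norm_ge(1)[OF assms, of 1] opnorm_nonneg[of "fst (x 1)"] by simp

lemma M_alg_plus_bound:
  assumes "x \<in> Carr M_alg" "y \<in> Carr M_alg" "n \<ge> 1"
  shows "opnorm (fst (x n) + fst (y n)) \<le> Norm M_alg x + Norm M_alg y"
    "opnorm (snd (x n) + snd (y n)) \<le> Norm M_alg x + Norm M_alg y"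
  using opnorm_add[OF M_algD(2)[OF assms(1,3)] M_algD(2)[OF assms(2,3)]]
    opnorm_add[OF M_algD(3)[OF assms(1,3)] M_algD(3)[OF assms(2,3)]]
    M_alg_norm_ge[OF assms(1,3)] M_alg_norm_ge[OF assms(2,3)] by linarith+

lemma M_alg_scale_bound:
  assumes "x \<in> Carr M_alg" "n \<ge> 1"
  shows "opnorm (z \<cdot>\<^sub>m fst (x n)) \<le> cmod z * Norm M_alg x"
    "opnorm (z \<cdot>\<^sub>m snd (x n)) \<le> cmod z * Norm M_alg x"
  using opnorm_smult M_alg_norm_ge[OF assms] by (meson mult_left_mono norm_ge_zero order_trans)+

lemma M_alg_times_bound:
  assumes "x \<in> Carr M_alg" "y \<in> Carr M_alg" "n \<ge> 1"
  shows "opnorm (fst (x n) * fst (y n)) \<le> Norm M_alg x * Norm M_alg y"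
    "opnorm (snd (x n) * snd (y n)) \<le> Norm M_alg x * Norm M_alg y"
  using opnorm_mult[OF M_algD(2)[OF assms(1,3)] M_algD(2)[OF assms(2,3)]]
    opnorm_mult[OF M_algD(3)[OF assms(1,3)] M_algD(3)[OF assms(2,3)]]
    mult_mono[OF M_alg_norm_ge(1)[OF assms(1,3)] M_alg_norm_ge(1)[OF assms(2,3)]]
    mult_mono[OF M_alg_norm_ge(2)[OF assms(1,3)] M_alg_norm_ge(2)[OF assms(2,3)]]
    M_alg_norm_nonneg[OF assms(1)] opnorm_nonneg by (meson order_trans)+

lemma M_alg_star_bound:
  assumes "x \<in> Carr M_alg" "n \<ge> 1"
  shows "opnorm (mat_adjoint (fst (x n))) \<le> Norm M_alg x"
    "opnorm (mat_adjoint (snd (x n))) \<le> Norm M_alg x"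
  using opnorm_adjoint M_alg_norm_ge[OF assms] order_trans by blast+

lemma zero_in_M_alg: "(\<lambda>n \<in> {1..}. (0\<^sub>m n n, 0\<^sub>m n n)) \<in> Carr M_alg"
  by (rule M_algI[where K = 0]) (simp_all add: opnorm_zero)

interpretation M: normed_star_algebra M_alg
proof (unfold_locales, goal_cases)
  case (1 x y)
  show ?case
    using M_alg_plus_bound[OF 1] M_algD[OF 1(1)] M_algD[OF 1(2)]
    by (intro M_algI[where K = "Norm M_alg x + Norm M_alg y"]) simp_all
next
  case (2 x z)
  show ?case
    using M_alg_scale_bound[OF 2] M_algD[OF 2]
    by (intro M_algI[where K = "cmod z * Norm M_alg x"]) simp_all
next
  case (3 x y)
  have "fst (x n) * fst (y n) \<in> carrier_mat n n" if "n \<ge> 1" for n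
    by (rule mult_carrier_mat[OF M_algD(2)[OF 3(1) that] M_algD(2)[OF 3(2) that]])
  moreover have "snd (x n) * snd (y n) \<in> carrier_mat n n" if "n \<ge> 1" for n
    by (rule mult_carrier_mat[OF M_algD(3)[OF 3(1) that] M_algD(3)[OF 3(2) that]])
  ultimately show ?case
    using M_alg_times_bound[OF 3]
    by (intro M_algI[where K = "Norm M_alg x * Norm M_alg y"]) simp_all
next
  case (4 x y w)
  show ?case
    using assoc_add_mat[OF M_algD(2)[OF 4(1)] M_algD(2)[OF 4(2)] M_algD(2)[OF 4(3)]]
      assoc_add_mat[OF M_algD(3)[OF 4(1)] M_algD(3)[OF 4(2)] M_algD(3)[OF 4(3)]]
    by (intro M_alg_eqI) simp_all
next
  case (5 x y)
  show ?case
    using comm_add_mat[OF M_algD(2)[OF 5(1)] M_algD(2)[OF 5(2)]]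
      comm_add_mat[OF M_algD(3)[OF 5(1)] M_algD(3)[OF 5(2)]]
    by (intro M_alg_eqI) simp_all
next
  case (6 x y z)
  show ?case
    using add_smult_distrib_left_mat[OF M_algD(2)[OF 6(1)] M_algD(2)[OF 6(2)]]
      add_smult_distrib_left_mat[OF M_algD(3)[OF 6(1)] M_algD(3)[OF 6(2)]]
    by (intro M_alg_eqI) simp_all
next
  case (7 x z z')
  show ?case
    using M_algD[OF 7] by (intro M_alg_eqI) (auto intro!: eq_matI simp: mult.assoc)
next
  case (8 x y w)
  show ?case
    using assoc_mult_mat[OF M_algD(2)[OF 8(1)] M_algD(2)[OF 8(2)] M_algD(2)[OF 8(3)]]
      assoc_mult_mat[OF M_algD(3)[OF 8(1)] M_algD(3)[OF 8(2)] M_algD(3)[OF 8(3)]]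
    by (intro M_alg_eqI) simp_all
next
  case (9 x y w)
  show ?case
    using mult_add_distrib_mat[OF M_algD(2)[OF 9(3)] M_algD(2)[OF 9(1)] M_algD(2)[OF 9(2)]]
      mult_add_distrib_mat[OF M_algD(3)[OF 9(3)] M_algD(3)[OF 9(1)] M_algD(3)[OF 9(2)]]
    by (intro M_alg_eqI) simp_all
next
  case (10 x y w)
  show ?case
    using add_mult_distrib_mat[OF M_algD(2)[OF 10(1)] M_algD(2)[OF 10(2)] M_algD(2)[OF 10(3)]]
      add_mult_distrib_mat[OF M_algD(3)[OF 10(1)] M_algD(3)[OF 10(2)] M_algD(3)[OF 10(3)]]
    by (intro M_alg_eqI) simp_all
next
  case (11 x y z)
  show ?case
    using mult_smult_distrib[OF M_algD(2)[OF 11(1)] M_algD(2)[OF 11(2)]]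
      mult_smult_distrib[OF M_algD(3)[OF 11(1)] M_algD(3)[OF 11(2)]]
    by (intro M_alg_eqI) simp_all
next
  case (12 x y z)
  show ?case
    using mult_smult_assoc_mat[OF M_algD(2)[OF 12(1)] M_algD(2)[OF 12(2)]]
      mult_smult_assoc_mat[OF M_algD(3)[OF 12(1)] M_algD(3)[OF 12(2)]]
    by (intro M_alg_eqI) simp_all
next
  case (13 x)
  then show ?case by (rule M_alg_norm_nonneg)
next
  case (14 x y)
  show ?case using M_alg_plus_bound[OF 14] by (intro M_alg_norm_le) simp_all
next
  case (15 x z)
  show ?case using M_alg_scale_bound[OF 15] by (intro M_alg_norm_le) simp_all
next
  case (16 x y)
  show ?case using M_alg_times_bound[OF 16] by (intro M_alg_norm_le) simp_all
next
  case 17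
  show ?case using zero_in_M_alg by blast
next
  case (18 x)
  show ?case
    using M_alg_star_bound[OF 18] M_algD[OF 18]
    by (intro M_algI[where K = "Norm M_alg x"]) (simp_all add: mat_adjoint_carrier)
next
  case (19 x y)
  show ?case
    using mat_adjoint_add[OF M_algD(2)[OF 19(1)] M_algD(2)[OF 19(2)]]
      mat_adjoint_add[OF M_algD(3)[OF 19(1)] M_algD(3)[OF 19(2)]]
    by (intro M_alg_eqI) simp_all
next
  case (20 x z)
  show ?case using M_algD[OF 20] by (intro M_alg_eqI) (simp_all add: mat_adjoint_smult)
next
  case (21 x)
  show ?case using M_alg_star_bound[OF 21] by (intro M_alg_norm_le) simp_all
qed

section \<open>Upper triangular Toeplitz matrices\<close>

text \<open>The polynomial with coefficients \<open>f\<close> evaluated at the nilpotent shift. The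
  blocks of \<open>u_k\<close> and of the averaging element have this form, so computations with
  them become computations with coefficient sequences.\<close>

definition upper_toeplitz :: "nat \<Rightarrow> (nat \<Rightarrow> complex) \<Rightarrow> complex mat" where
  "upper_toeplitz n f = Matrix.mat n n (\<lambda>(i, j). if i \<le> j then f (j - i) else 0)"

lemma upper_toeplitz_carrier [simp]: "upper_toeplitz n f \<in> carrier_mat n n"
  by (simp add: upper_toeplitz_def)

lemma upper_toeplitz_dim [simp]:
  "dim_row (upper_toeplitz n f) = n" "dim_col (upper_toeplitz n f) = n"
  by (simp_all add: upper_toeplitz_def)

lemma upper_toeplitz_one: "1\<^sub>m n = upper_toeplitz n (\<lambda>t. if t = 0 then 1 else 0)"
  unfolding upper_toeplitz_def by (intro eq_matI) auto

lemma upper_toeplitz_add: "upper_toeplitz n f + upper_toeplitz n g = upper_toeplitz n (\<lambda>t. f t + g t)"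
  unfolding upper_toeplitz_def by (intro eq_matI) auto

lemma upper_toeplitz_smult: "z \<cdot>\<^sub>m upper_toeplitz n f = upper_toeplitz n (\<lambda>t. z * f t)"
  unfolding upper_toeplitz_def by (intro eq_matI) auto

text \<open>Intermediate indices \<open>l\<close> contribute from \<open>r\<close> to
  \<open>s\<close>; substituting \<open>i = l - r\<close> gives the Cauchy product of the
  coefficients.\<close>

lemma upper_toeplitz_mult:
  "upper_toeplitz n f * upper_toeplitz n g = upper_toeplitz n (\<lambda>t. \<Sum>i\<le>t. f i * g (t - i))"
proof (rule eq_matI)
  fix r s assume "r < dim_row (upper_toeplitz n (\<lambda>t. \<Sum>i\<le>t. f i * g (t - i)))"
    "s < dim_col (upper_toeplitz n (\<lambda>t. \<Sum>i\<le>t. f i * g (t - i)))"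
  then have r: "r < n" and s: "s < n" by (simp_all add: upper_toeplitz_def)
  have "(upper_toeplitz n f * upper_toeplitz n g) $$ (r, s) =
      (\<Sum>l<n. (if r \<le> l then f (l - r) else 0) * (if l \<le> s then g (s - l) else 0))"
    using r s by (simp add: upper_toeplitz_def scalar_prod_def lessThan_atLeast0)
  also have "\<dots> = (\<Sum>l\<in>{r..s}. f (l - r) * g (s - l))"
    using s by (intro sum.mono_neutral_cong_right) auto
  also have "\<dots> = (if r \<le> s then \<Sum>i\<le>s - r. f i * g (s - r - i) else 0)"
  proof (cases "r \<le> s")
    case True
    have "(\<Sum>i\<le>s - r. f i * g (s - r - i)) = (\<Sum>l\<in>{r..s}. f (l - r) * g (s - l))"
      using True by (intro sum.reindex_bij_witness[of _ "\<lambda>l. l - r" "\<lambda>i. i + r"]) (auto simp: add.commute)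
    then show ?thesis using True by simp
  qed simp
  also have "\<dots> = upper_toeplitz n (\<lambda>t. \<Sum>i\<le>t. f i * g (t - i)) $$ (r, s)"
    using r s by (simp add: upper_toeplitz_def)
  finally show "(upper_toeplitz n f * upper_toeplitz n g) $$ (r, s) =
      upper_toeplitz n (\<lambda>t. \<Sum>i\<le>t. f i * g (t - i)) $$ (r, s)" .
qed (simp_all add: upper_toeplitz_def)

lemma upper_toeplitz_commute:
  "upper_toeplitz n f * upper_toeplitz n g = upper_toeplitz n g * upper_toeplitz n f"
proof -
  have "(\<Sum>i\<le>t. f i * g (t - i)) = (\<Sum>i\<le>t. g i * f (t - i))" for t
    by (rule sum.reindex_bij_witness[of _ "\<lambda>i. t - i" "\<lambda>i. t - i"]) auto
  then show ?thesis by (simp add: upper_toeplitz_mult)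
qed

text \<open>A row or a column contains each coefficient at most once, so both bounds in Schur's test
  are partial sums of the moduli of the coefficients.\<close>

lemma opnorm_upper_toeplitz:
  assumes "(\<Sum>t<n. cmod (f t)) \<le> \<beta>"
  shows "opnorm (upper_toeplitz n f) \<le> \<beta>"
proof (rule opnorm_leI)
  show \<beta>: "0 \<le> \<beta>" by (rule order_trans[OF _ assms]) (simp add: sum_nonneg)
  fix v :: "complex Matrix.vec" assume v: "v \<in> carrier_vec (dim_col (upper_toeplitz n f))"
  have entry: "cmod (upper_toeplitz n f $$ (i, j)) = (if i \<le> j then cmod (f (j - i)) else 0)"
    if "i < n" "j < n" for i j
    using that by (simp add: upper_toeplitz_def)
  have part: "(\<Sum>t<m. cmod (f t)) \<le> \<beta>" if "m \<le> n" for m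
    using sum_mono2[of "{..<n}" "{..<m}" "\<lambda>t. cmod (f t)"] that assms by auto
  have row: "(\<Sum>j<n. cmod (upper_toeplitz n f $$ (i, j))) \<le> \<beta>" if "i < n" for i
  proof -
    have "(\<Sum>j<n. cmod (upper_toeplitz n f $$ (i, j))) = (\<Sum>j\<in>{i..<n}. cmod (f (j - i)))"
      using that by (intro sum.mono_neutral_cong_right) (auto simp: entry)
    also have "\<dots> = (\<Sum>t<n - i. cmod (f t))"
      by (rule sum.reindex_bij_witness[of _ "\<lambda>t. t + i" "\<lambda>j. j - i"]) auto
    finally show ?thesis using part by simp
  qed
  have col: "(\<Sum>i<n. cmod (upper_toeplitz n f $$ (i, j))) \<le> \<beta>" if "j < n" for j
  proof -
    have "(\<Sum>i<n. cmod (upper_toeplitz n f $$ (i, j))) = (\<Sum>i\<in>{..j}. cmod (f (j - i)))"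
      using that by (intro sum.mono_neutral_cong_right) (auto simp: entry)
    also have "\<dots> = (\<Sum>t<Suc j. cmod (f t))"
      by (rule sum.reindex_bij_witness[of _ "\<lambda>t. j - t" "\<lambda>i. j - i"]) auto
    finally show ?thesis using part[of "Suc j"] that by simp
  qed
  show "l2norm (upper_toeplitz n f *\<^sub>v v) \<le> \<beta> * l2norm v"
    by (intro schur_test[OF v \<beta>]) (simp_all add: row col)
qed

lemma mat_diag_conj:
  assumes "X \<in> carrier_mat n n"
  shows "mat_diag n f * X * mat_diag n g = Matrix.mat n n (\<lambda>(i, j). f i * X $$ (i, j) * g j)"
proof -
  define Y where "Y = Matrix.mat n n (\<lambda>(i, j). f i * X $$ (i, j))"
  have "mat_diag n f * X = Y" unfolding Y_def by (rule mat_diag_mult_left[OF assms])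
  moreover have "Y * mat_diag n g = Matrix.mat n n (\<lambda>(i, j). Y $$ (i, j) * g j)"
    by (rule mat_diag_mult_right) (simp add: Y_def)
  ultimately show ?thesis by (auto intro!: eq_matI simp: Y_def)
qed

text \<open>Conjugation multiplies the entry at \<open>(i, j)\<close> by the power of
  \<open>c n\<close> with exponent \<open>i - j\<close>. This factor is constant along diagonals, so
  the matrix stays Toeplitz.\<close>

lemma d_conj_upper_toeplitz:
  assumes "c n \<noteq> 0"
  shows "d_mat c n * upper_toeplitz n f * d_inv c n = upper_toeplitz n (\<lambda>t. f t / complex_of_real (c n) ^ t)"
proof -
  have *: "complex_of_real (c n ^ Suc i) * z * complex_of_real (inverse (c n ^ Suc j)) =
      z / complex_of_real (c n) ^ (j - i)" if ij: "i \<le> j" for i j z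
  proof -
    obtain t where j: "j = i + t" using le_Suc_ex[OF ij] by blast
    have cancel: "a * z * inverse (a * b) = z / b" if "a \<noteq> 0" for a b :: complex
      using that by (cases "b = 0") (simp_all add: field_simps)
    have "complex_of_real (c n ^ Suc j) = complex_of_real (c n ^ Suc i) * complex_of_real (c n) ^ t"
      unfolding j by (simp add: power_add)
    then have "complex_of_real (c n ^ Suc i) * z * complex_of_real (inverse (c n ^ Suc j)) =
        complex_of_real (c n ^ Suc i) * z * inverse (complex_of_real (c n ^ Suc i) * complex_of_real (c n) ^ t)"
      by (simp only: of_real_inverse)
    also have "\<dots> = z / complex_of_real (c n) ^ t" using assms by (intro cancel) simp
    finally show ?thesis by (simp add: j)
  qed
  show ?thesis
  proof (rule eq_matI)
    fix i j assume "i < dim_row (upper_toeplitz n (\<lambda>t. f t / complex_of_real (c n) ^ t))"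
      "j < dim_col (upper_toeplitz n (\<lambda>t. f t / complex_of_real (c n) ^ t))"
    then have ij: "i < n" "j < n" by simp_all
    have "(d_mat c n * upper_toeplitz n f * d_inv c n) $$ (i, j) =
        complex_of_real (c n ^ Suc i) * upper_toeplitz n f $$ (i, j) * complex_of_real (inverse (c n ^ Suc j))"
      unfolding d_mat_def d_inv_def mat_diag_conj[OF upper_toeplitz_carrier] using ij by simp
    also have "\<dots> = upper_toeplitz n (\<lambda>t. f t / complex_of_real (c n) ^ t) $$ (i, j)"
    proof (cases "i \<le> j")
      case True
      then have "upper_toeplitz n g $$ (i, j) = g (j - i)" for g
        using ij by (simp add: upper_toeplitz_def)
      then show ?thesis by (simp only: *[OF True])
    next
      case False
      then have "upper_toeplitz n g $$ (i, j) = 0" for g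
        using ij by (simp add: upper_toeplitz_def)
      then show ?thesis by simp
    qed
    finally show "(d_mat c n * upper_toeplitz n f * d_inv c n) $$ (i, j) =
        upper_toeplitz n (\<lambda>t. f t / complex_of_real (c n) ^ t) $$ (i, j)" .
  qed (simp_all add: d_mat_def d_inv_def mat_diag_def)
qed

text \<open>For \<open>c n \<ge> 1\<close> conjugation only damps the superdiagonals, so an estimate
  of the coefficients for the first component of a tuple holds for the second as well.\<close>

lemma opnorm_d_conj_upper_toeplitz:
  assumes "c n \<ge> 1" "(\<Sum>t<n. cmod (f t)) \<le> \<beta>"
  shows "opnorm (d_mat c n * upper_toeplitz n f * d_inv c n) \<le> \<beta>"
proof -
  have "cmod (f t / complex_of_real (c n) ^ t) \<le> cmod (f t)" for t
  proof -
    have "c n ^ t \<ge> 1" using assms(1) by (rule one_le_power)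
    then have "cmod (f t) * 1 \<le> cmod (f t) * c n ^ t" by (intro mult_left_mono) auto
    then show ?thesis using assms(1) \<open>c n ^ t \<ge> 1\<close> by (simp add: norm_divide norm_power divide_le_eq)
  qed
  then have "(\<Sum>t<n. cmod (f t / complex_of_real (c n) ^ t)) \<le> \<beta>"
    by (intro order_trans[OF sum_mono assms(2)])
  then show ?thesis
    using assms(1) by (subst d_conj_upper_toeplitz) (auto intro: opnorm_upper_toeplitz)
qed

section \<open>The averages of powers of the shift\<close>

lemma E_set_subset: "E_set n k \<subseteq> {..2 * n}"
proof
  fix i assume "i \<in> E_set n k"
  then have i: "real i \<le> 2 * real n / real k" by (simp add: E_set_def)
  \<comment> \<open>The case \<open>k = 0\<close> is separate because division by zero yields
    \<open>0\<close>; there \<open>E_set n 0\<close> is \<open>{0}\<close>.\<close>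
  show "i \<in> {..2 * n}"
  proof (cases "k = 0")
    case False
    then have "2 * real n / real k \<le> 2 * real n / 1" by (intro divide_left_mono) auto
    with i show ?thesis by simp
  qed (use i in simp)
qed

lemma finite_E_set: "finite (E_set n k)"
  using finite_subset[OF E_set_subset] by blast

lemma E_set_nonempty:
  assumes "1 \<le> k" "k \<le> n"
  shows "E_set n k \<noteq> {}"
proof -
  \<comment> \<open>With \<open>x = n/k \<ge> 1\<close> the interval from \<open>x\<close> to
    \<open>2x\<close> has length at least 1, so it contains the ceiling of \<open>x\<close>.\<close>
  have "nat \<lceil>real n / real k\<rceil> \<in> E_set n k"
  proof -
    have "1 \<le> real n / real k" using assms by simp
    then have "real (nat \<lceil>real n / real k\<rceil>) \<le> real n / real k + real n / real k" by linarith
    moreover have "real n / real k \<le> real (nat \<lceil>real n / real k\<rceil>)" by linarith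
    ultimately show ?thesis by (simp add: E_set_def)
  qed
  then show ?thesis by blast
qed

lemma shiftL_power: "shiftL n ^\<^sub>m i = upper_toeplitz n (\<lambda>t. if t = i then 1 else 0)"
proof (induction i)
  case 0
  show ?case by (simp add: upper_toeplitz_one shiftL_def)
next
  case (Suc i)
  have "shiftL n = upper_toeplitz n (\<lambda>t. if t = 1 then 1 else 0)"
    unfolding shiftL_def upper_toeplitz_def by (intro eq_matI) auto
  moreover have "(\<Sum>j\<le>t. (if j = i then 1 else 0) * (if t - j = 1 then 1 else 0)) =
      (if t = Suc i then 1 else 0 :: complex)" for t
  proof -
    have "(\<Sum>j\<le>t. (if j = i then 1 else 0) * (if t - j = 1 then 1 else 0)) =
      (\<Sum>j\<le>t. if j = i then (if t - i = 1 then 1 else 0) else 0 :: complex)"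
      by (intro sum.cong) auto
    then show ?thesis by (auto simp: sum.delta)
  qed
  ultimately show ?case using Suc by (simp add: upper_toeplitz_mult)
qed

text \<open>For \<open>k \<ge> 1\<close> these are probability weights on the exponents of the
  shift; they are kept real so that partial sums can be compared.\<close>

definition u_coeff :: "nat \<Rightarrow> nat \<Rightarrow> nat \<Rightarrow> real" where
  "u_coeff n k t = (if k \<le> n then (if t \<in> E_set n k then 1 / real (card (E_set n k)) else 0)
     else (if t = 0 then 1 else 0))"

lemma u_mat_eq: "u_mat n k = upper_toeplitz n (\<lambda>t. complex_of_real (u_coeff n k t))"
proof (cases "k \<le> n")
  case True
  have "1 / of_nat (card (E_set n k)) * (\<Sum>i \<in> E_set n k. (shiftL n ^\<^sub>m i) $$ (r, s)) =
      (if r \<le> s then complex_of_real (u_coeff n k (s - r)) else 0)" if "r < n" "s < n" for r s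
  proof -
    have "(\<Sum>i \<in> E_set n k. (shiftL n ^\<^sub>m i) $$ (r, s)) =
        (\<Sum>i \<in> E_set n k. if s - r = i then (if r \<le> s then 1 else 0) else 0)"
      using that by (intro sum.cong) (auto simp: shiftL_power upper_toeplitz_def)
    also have "\<dots> = (if r \<le> s \<and> s - r \<in> E_set n k then 1 else 0)"
      using finite_E_set by (simp add: sum.delta')
    finally show ?thesis using True by (simp add: u_coeff_def)
  qed
  then show ?thesis
    using True unfolding u_mat_def upper_toeplitz_def by (intro eq_matI) auto
qed (simp add: u_mat_def u_coeff_def upper_toeplitz_one if_distrib[of complex_of_real] cong: if_cong)

lemma u_coeff_nonneg: "0 \<le> u_coeff n k t"
  by (simp add: u_coeff_def)

lemma sum_u_coeff_le:
  assumes "finite T"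
  shows "(\<Sum>t\<in>T. u_coeff n k t) \<le> 1"
proof (cases "k \<le> n")
  case True
  have "(\<Sum>t\<in>T. u_coeff n k t) = (\<Sum>t\<in>T \<inter> E_set n k. 1 / real (card (E_set n k)))"
    using assms True by (intro sum.mono_neutral_cong_right) (auto simp: u_coeff_def)
  also have "\<dots> = real (card (T \<inter> E_set n k)) / real (card (E_set n k))" by simp
  also have "\<dots> \<le> 1"
    using card_mono[OF finite_E_set[of n k], of "T \<inter> E_set n k"] by (auto simp: divide_le_eq_1)
  finally show ?thesis .
qed (use assms in \<open>simp add: u_coeff_def sum.delta'\<close>)

text \<open>No weight lies beyond the exponent \<open>2n/k\<close>, so from there on a partial sum
  has collected the total mass. The assumption \<open>k \<ge> 1\<close> makes
  \<open>E_set n k\<close> nonempty when \<open>k \<le> n\<close>.\<close>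

lemma sum_u_coeff_eq:
  assumes "k \<ge> 1" "n < k \<or> 2 * real n / real k \<le> real t"
  shows "(\<Sum>i\<le>t. u_coeff n k i) = 1"
proof (cases "k \<le> n")
  case True
  then have "2 * real n / real k \<le> real t" using assms(2) by simp
  then have sub: "E_set n k \<subseteq> {..t}" by (auto simp: E_set_def)
  have "(\<Sum>i\<le>t. u_coeff n k i) = (\<Sum>i\<in>E_set n k. 1 / real (card (E_set n k)))"
    using sub True by (intro sum.mono_neutral_cong_right) (auto simp: u_coeff_def)
  also have "\<dots> = 1"
    using E_set_nonempty[OF assms(1) True] finite_E_set by simp
  finally show ?thesis .
qed (simp add: u_coeff_def)

lemma card_less_real:
  assumes "0 \<le> x"
  shows "real (card {t::nat. real t < x}) \<le> x + 1" "finite {t::nat. real t < x}"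
proof -
  have sub: "{t::nat. real t < x} \<subseteq> {..nat \<lfloor>x\<rfloor>}" by (auto simp: le_nat_floor)
  then show "finite {t::nat. real t < x}" by (rule finite_subset) simp
  have "card {t::nat. real t < x} \<le> nat \<lfloor>x\<rfloor> + 1" using card_mono[OF _ sub] by simp
  then show "real (card {t::nat. real t < x}) \<le> x + 1" using assms by linarith
qed

text \<open>The summands are the coefficients of \<open>u a - a\<close> in block \<open>n\<close>,
  where \<open>a\<close> has all coefficients \<open>1/n\<close>. They vanish from the exponent
  \<open>2n/k\<close> on; at most \<open>2n/k + 1\<close> remain, each at most \<open>1/n\<close>,
  which gives \<open>2/k + 1/n\<close>. Since \<open>k \<le> n\<close>, the rounding term is at most
  \<open>1/k\<close>, whence the 3. For \<open>n < k\<close> the block of \<open>u\<close> is the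
  identity.\<close>

lemma averaging_defect:
  assumes "k \<ge> 1" "n \<ge> 1"
  shows "(\<Sum>t<n. \<bar>1 / real n * (\<Sum>i\<le>t. u_coeff n k i) - 1 / real n\<bar>) \<le> 3 / real k"
proof (cases "k \<le> n")
  case True
  define T where "T = {t::nat. real t < 2 * real n / real k}"
  have T: "finite T" "real (card T) \<le> 2 * real n / real k + 1"
    using card_less_real[of "2 * real n / real k"] by (simp_all add: T_def)
  have le: "\<bar>1 / real n * (\<Sum>i\<le>t. u_coeff n k i) - 1 / real n\<bar> \<le> (if t \<in> T then 1 / real n else 0)" for t
  proof (cases "t \<in> T")
    case True
    have s: "0 \<le> (\<Sum>i\<le>t. u_coeff n k i)" "(\<Sum>i\<le>t. u_coeff n k i) \<le> 1"
      by (simp_all add: sum_nonneg u_coeff_nonneg sum_u_coeff_le)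
    have "1 / real n * (\<Sum>i\<le>t. u_coeff n k i) \<le> 1 / real n * 1"
      using s(2) by (intro mult_left_mono) auto
    moreover have "0 \<le> 1 / real n * (\<Sum>i\<le>t. u_coeff n k i)" using s(1) by simp
    ultimately show ?thesis using True by (simp add: abs_le_iff)
  next
    case False
    then show ?thesis using sum_u_coeff_eq[OF assms(1)] by (simp add: T_def)
  qed
  have "(\<Sum>t<n. \<bar>1 / real n * (\<Sum>i\<le>t. u_coeff n k i) - 1 / real n\<bar>) \<le> (\<Sum>t<n. if t \<in> T then 1 / real n else 0)"
    by (intro sum_mono le)
  also have "\<dots> = (\<Sum>t\<in>{..<n} \<inter> T. 1 / real n)" by (rule sum.inter_restrict[symmetric]) simp
  also have "\<dots> = real (card ({..<n} \<inter> T)) / real n" by simp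
  also have "\<dots> \<le> real (card T) / real n"
    using card_mono[OF T(1), of "{..<n} \<inter> T"] by (simp add: divide_right_mono)
  also have "\<dots> \<le> (2 * real n / real k + 1) / real n" using T(2) by (simp add: divide_right_mono)
  also have "\<dots> = 2 / real k + 1 / real n" using assms by (simp add: field_simps)
  also have "\<dots> \<le> 3 / real k"
    using True assms frac_le[of 1 1 "real k" "real n"] by (simp add: field_simps)
  finally show ?thesis .
qed (use sum_u_coeff_eq[OF assms(1)] in simp)

section \<open>The algebras N and A\<close>

lemma tup_index: "n \<ge> 1 \<Longrightarrow> tup c x n = (x n, d_mat c n * x n * d_inv c n)"
  by (simp add: tup_def)

lemma d_mat_carrier [simp]: "d_mat c n \<in> carrier_mat n n" "d_inv c n \<in> carrier_mat n n"
  by (simp_all add: d_mat_def d_inv_def)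

lemma tup_extensional [simp]: "tup c x \<in> extensional {Suc 0..}"
  by (auto simp: tup_def)

lemma tup_eqI: "(\<And>n. n \<ge> 1 \<Longrightarrow> x n = y n) \<Longrightarrow> tup c x = tup c y"
  by (auto simp: tup_def fun_eq_iff restrict_def)

lemma tup_plus:
  assumes "\<And>n. n \<ge> 1 \<Longrightarrow> x n \<in> carrier_mat n n" "\<And>n. n \<ge> 1 \<Longrightarrow> y n \<in> carrier_mat n n"
  shows "Plus M_alg (tup c x) (tup c y) = tup c (\<lambda>n. x n + y n)"
proof (rule M_alg_eqI)
  fix n :: nat assume n: "n \<ge> 1"
  note car = assms(1)[OF n] assms(2)[OF n] d_mat_carrier[of c n]
  show "fst (Plus M_alg (tup c x) (tup c y) n) = fst (tup c (\<lambda>n. x n + y n) n)"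
    using n by (simp add: tup_index)
  have "d_mat c n * (x n + y n) * d_inv c n = (d_mat c n * x n + d_mat c n * y n) * d_inv c n"
    by (simp add: mult_add_distrib_mat[OF d_mat_carrier(1) assms(1)[OF n] assms(2)[OF n]])
  also have "\<dots> = d_mat c n * x n * d_inv c n + d_mat c n * y n * d_inv c n"
    using car by (intro add_mult_distrib_mat[of _ n n _ _ n] mult_carrier_mat[of _ n n])
  finally show "snd (Plus M_alg (tup c x) (tup c y) n) = snd (tup c (\<lambda>n. x n + y n) n)"
    using n by (simp add: tup_index)
qed simp_all

lemma tup_scale:
  assumes "\<And>n. n \<ge> 1 \<Longrightarrow> x n \<in> carrier_mat n n"
  shows "Scale M_alg z (tup c x) = tup c (\<lambda>n. z \<cdot>\<^sub>m x n)"
proof (rule M_alg_eqI)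
  fix n :: nat assume n: "n \<ge> 1"
  note car = assms(1)[OF n] d_mat_carrier[of c n]
  show "fst (Scale M_alg z (tup c x) n) = fst (tup c (\<lambda>n. z \<cdot>\<^sub>m x n) n)"
    using n by (simp add: tup_index)
  have "d_mat c n * (z \<cdot>\<^sub>m x n) * d_inv c n = (z \<cdot>\<^sub>m (d_mat c n * x n)) * d_inv c n"
    by (simp add: mult_smult_distrib[OF d_mat_carrier(1) assms(1)[OF n]])
  also have "\<dots> = z \<cdot>\<^sub>m (d_mat c n * x n * d_inv c n)"
    using car by (intro mult_smult_assoc_mat[of _ n n _ n] mult_carrier_mat[of _ n n])
  finally show "snd (Scale M_alg z (tup c x) n) = snd (tup c (\<lambda>n. z \<cdot>\<^sub>m x n) n)"
    using n by (simp add: tup_index)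
qed simp_all

lemma tup_times:
  assumes "\<And>n. n \<ge> 1 \<Longrightarrow> x n \<in> carrier_mat n n" "\<And>n. n \<ge> 1 \<Longrightarrow> y n \<in> carrier_mat n n"
    and c: "\<And>n. n \<ge> 1 \<Longrightarrow> c n \<noteq> 0"
  shows "Times M_alg (tup c x) (tup c y) = tup c (\<lambda>n. x n * y n)"
proof (rule M_alg_eqI)
  fix n :: nat assume n: "n \<ge> 1"
  show "fst (Times M_alg (tup c x) (tup c y) n) = fst (tup c (\<lambda>n. x n * y n) n)"
    using n by (simp add: tup_index)
  define d e X Y where "d = d_mat c n" and "e = d_inv c n" and "X = x n" and "Y = y n"
  have car: "d \<in> carrier_mat n n" "e \<in> carrier_mat n n" "X \<in> carrier_mat n n" "Y \<in> carrier_mat n n"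
    using assms(1,2)[OF n] by (simp_all add: d_def e_def X_def Y_def)
  \<comment> \<open>Cancelling this inner product makes conjugation multiplicative, so that the
    second components multiply like the first.\<close>
  have ed: "e * d = 1\<^sub>m n" unfolding d_def e_def by (rule d_mat_inverse(2)[where c = c, OF c[OF n]])
  have "d * X * e * (d * Y * e) = d * X * (e * d * Y * e)"
    using car by (smt (verit) assoc_mult_mat mult_carrier_mat)
  also have "\<dots> = d * (X * Y) * e"
    using car by (simp add: ed) (smt (verit) assoc_mult_mat mult_carrier_mat)
  finally show "snd (Times M_alg (tup c x) (tup c y) n) = snd (tup c (\<lambda>n. x n * y n) n)"
    using n by (simp add: tup_index d_def e_def X_def Y_def)
qed simp_all

lemma tup_minus:
  assumes "\<And>n. n \<ge> 1 \<Longrightarrow> x n \<in> carrier_mat n n" "\<And>n. n \<ge> 1 \<Longrightarrow> y n \<in> carrier_mat n n"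
  shows "Minus M_alg (tup c x) (tup c y) = tup c (\<lambda>n. x n + (- 1) \<cdot>\<^sub>m y n)"
  using assms unfolding Minus_def by (simp add: tup_plus tup_scale del: M_alg_simps)

lemma tup_times_minus:
  assumes "\<And>n. n \<ge> 1 \<Longrightarrow> x n \<in> carrier_mat n n" "\<And>n. n \<ge> 1 \<Longrightarrow> y n \<in> carrier_mat n n"
    "\<And>n. n \<ge> 1 \<Longrightarrow> w n \<in> carrier_mat n n" and c: "\<And>n. n \<ge> 1 \<Longrightarrow> c n \<noteq> 0"
  shows "Minus M_alg (Times M_alg (tup c x) (tup c y)) (tup c w) = tup c (\<lambda>n. x n * y n + (- 1) \<cdot>\<^sub>m w n)"
proof -
  have "Times M_alg (tup c x) (tup c y) = tup c (\<lambda>n. x n * y n)"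
    using assms by (intro tup_times)
  moreover have "x n * y n \<in> carrier_mat n n" if "n \<ge> 1" for n
    using assms(1,2)[OF that] by (rule mult_carrier_mat)
  ultimately show ?thesis
    using tup_minus[of "\<lambda>n. x n * y n" w c] assms(3) by (simp del: M_alg_simps)
qed

lemma N_algI:
  assumes "\<And>n. n \<ge> 1 \<Longrightarrow> x n \<in> carrier_mat n n"
    and "\<And>n. n \<ge> 1 \<Longrightarrow> opnorm (x n) \<le> K" "\<And>n. n \<ge> 1 \<Longrightarrow> opnorm (d_mat c n * x n * d_inv c n) \<le> K"
  shows "tup c x \<in> N_alg c"
proof -
  have "d_mat c n * x n * d_inv c n \<in> carrier_mat n n" if "n \<ge> 1" for n
    using assms(1)[OF that] by (intro mult_carrier_mat[of _ n n] d_mat_carrier) auto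
  then have "tup c x \<in> Carr M_alg"
    using assms by (intro M_algI[where K = K]) (simp_all add: tup_index)
  then show ?thesis using assms(1) unfolding N_alg_def by blast
qed

lemma N_algE:
  assumes "a \<in> N_alg c"
  obtains x where "a = tup c x" "\<And>n. n \<ge> 1 \<Longrightarrow> x n \<in> carrier_mat n n"
  using assms unfolding N_alg_def by blast

lemma tup_norm_le:
  assumes "\<And>n. n \<ge> 1 \<Longrightarrow> opnorm (x n) \<le> K" "\<And>n. n \<ge> 1 \<Longrightarrow> opnorm (d_mat c n * x n * d_inv c n) \<le> K"
  shows "Norm M_alg (tup c x) \<le> K"
  using assms by (intro M_alg_norm_le) (simp_all add: tup_index)

lemma N_alg_closed:
  assumes c: "\<And>n. n \<ge> 1 \<Longrightarrow> c n \<noteq> 0" and x: "x \<in> N_alg c" and y: "y \<in> N_alg c"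
  shows "Plus M_alg x y \<in> N_alg c" "Scale M_alg z x \<in> N_alg c" "Times M_alg x y \<in> N_alg c"
proof -
  obtain x' where x': "x = tup c x'" "\<And>n. n \<ge> 1 \<Longrightarrow> x' n \<in> carrier_mat n n" using N_algE[OF x] by metis
  obtain y' where y': "y = tup c y'" "\<And>n. n \<ge> 1 \<Longrightarrow> y' n \<in> carrier_mat n n" using N_algE[OF y] by metis
  have M: "x \<in> Carr M_alg" "y \<in> Carr M_alg" using x y unfolding N_alg_def by auto
  have N: "tup c w \<in> N_alg c" if "tup c w \<in> Carr M_alg" "\<And>n. n \<ge> 1 \<Longrightarrow> w n \<in> carrier_mat n n" for w
    using that unfolding N_alg_def by blast
  have car: "x' n + y' n \<in> carrier_mat n n" "z \<cdot>\<^sub>m x' n \<in> carrier_mat n n" "x' n * y' n \<in> carrier_mat n n"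
    if "n \<ge> 1" for n
    using x'(2)[OF that] y'(2)[OF that] by auto
  have eqs: "Plus M_alg x y = tup c (\<lambda>n. x' n + y' n)" "Scale M_alg z x = tup c (\<lambda>n. z \<cdot>\<^sub>m x' n)"
    "Times M_alg x y = tup c (\<lambda>n. x' n * y' n)"
    unfolding x'(1) y'(1)
    by (rule tup_plus[OF x'(2) y'(2)] tup_scale[OF x'(2)] tup_times[OF x'(2) y'(2) c]; assumption)+
  show "Plus M_alg x y \<in> N_alg c"
    using M.plus_closed[OF M] car(1) unfolding eqs by (rule N)
  show "Scale M_alg z x \<in> N_alg c"
    using M.scale_closed[OF M(1), of z] car(2) unfolding eqs by (rule N)
  show "Times M_alg x y \<in> N_alg c"
    using M.times_closed[OF M] car(3) unfolding eqs by (rule N)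
qed

lemma u_tup_in_N_alg:
  assumes "\<And>n. n \<ge> 1 \<Longrightarrow> c n \<ge> 1"
  shows "u_tup c k \<in> N_alg c"
proof -
  have "(\<Sum>t<n. cmod (complex_of_real (u_coeff n k t))) \<le> 1" for n
    using sum_u_coeff_le[of "{..<n}"] by (simp add: u_coeff_nonneg)
  then show ?thesis
    unfolding u_tup_def using assms
    by (intro N_algI[where K = 1])
      (auto simp: u_mat_eq intro: opnorm_upper_toeplitz opnorm_d_conj_upper_toeplitz)
qed

section \<open>Block units, the averaging element and the mean functionals\<close>

lemma d_conj_zero: "d_mat c n * 0\<^sub>m n n * d_inv c n = 0\<^sub>m n n"
  by (simp add: right_mult_zero_mat[OF d_mat_carrier(1)] left_mult_zero_mat[OF d_mat_carrier(2)])

lemma d_conj_one: "c n \<noteq> 0 \<Longrightarrow> d_mat c n * 1\<^sub>m n * d_inv c n = 1\<^sub>m n"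
  by (simp add: right_mult_one_mat[OF d_mat_carrier(1)] d_mat_inverse)

text \<open>Every block is a scalar matrix and so is fixed by conjugation with \<open>d_n\<close>;
  this makes the tuple selfadjoint in \<open>M\<close> although it lies in \<open>N\<close>.\<close>

definition block_unit :: "(nat \<Rightarrow> real) \<Rightarrow> nat \<Rightarrow> tuple" where
  "block_unit c m = tup c (\<lambda>n. if n \<le> m then 1\<^sub>m n else 0\<^sub>m n n)"

definition averaging_tup :: "(nat \<Rightarrow> real) \<Rightarrow> tuple" where
  "averaging_tup c = tup c (\<lambda>n. upper_toeplitz n (\<lambda>_. 1 / of_nat n))"

text \<open>For \<open>n \<ge> 1\<close> this is the vector state of the first component at the
  normalized constant vector. For \<open>n = 0\<close> the sum is empty, so the unspecified block
  \<open>0\<close> is never read.\<close>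

definition mean :: "nat \<Rightarrow> tuple \<Rightarrow> complex" where
  "mean n y = (\<Sum>i<n. \<Sum>j<n. fst (y n) $$ (i, j)) / of_nat n"

text \<open>Cauchy-Schwarz for the constant vector \<open>v\<close>, whose norm squared is
  \<open>n\<close>, cancels the division by \<open>n\<close>.\<close>

lemma mean_bound:
  assumes "y \<in> Carr M_alg"
  shows "cmod (mean n y) \<le> Norm M_alg y"
proof (cases "n = 0")
  case True
  then show ?thesis using M_alg_norm_nonneg[OF assms] by (simp add: mean_def)
next
  case False
  define X where "X = fst (y n)"
  define v where "v = Matrix.vec n (\<lambda>_. 1 :: complex)"
  have X: "X \<in> carrier_mat n n" using M_algD(2)[OF assms] False by (simp add: X_def)
  have v: "l2norm v = sqrt (real n)" by (simp add: v_def l2norm_def L2_set_def)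
  have "(\<Sum>i<n. \<Sum>j<n. X $$ (i, j)) = (\<Sum>i<dim_vec v. v $ i * (X *\<^sub>v v) $ i)"
    using X by (simp add: v_def scalar_prod_def lessThan_atLeast0)
  then have "cmod (\<Sum>i<n. \<Sum>j<n. X $$ (i, j)) \<le> l2norm v * l2norm (X *\<^sub>v v)"
    using l2norm_inner[of v "X *\<^sub>v v"] X by (simp add: v_def)
  also have "\<dots> \<le> l2norm v * (opnorm X * l2norm v)"
    using X by (intro mult_left_mono opnorm_ineq l2norm_nonneg) (simp add: v_def)
  also have "\<dots> = real n * opnorm X" unfolding v by simp
  also have "\<dots> \<le> real n * Norm M_alg y"
    using M_alg_norm_ge(1)[OF assms, of n] False by (intro mult_left_mono) (auto simp: X_def)
  finally show ?thesis using False by (simp add: mean_def X_def norm_divide divide_le_eq mult.commute)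
qed

text \<open>Row \<open>i\<close> has \<open>n - i\<close> entries equal to \<open>1/n\<close>, so
  the mean is \<open>(n + 1)/(2n)\<close>.\<close>

lemma mean_averaging_tup:
  assumes "n \<ge> 1"
  shows "1 / 2 \<le> cmod (mean n (averaging_tup c))"
proof -
  have "(\<Sum>i<n. \<Sum>j<n. fst (averaging_tup c n) $$ (i, j)) = (\<Sum>i<n. of_nat (n - i) / of_nat n :: complex)"
  proof (rule sum.cong[OF refl])
    fix i assume "i \<in> {..<n}"
    then have "(\<Sum>j<n. fst (averaging_tup c n) $$ (i, j)) = (\<Sum>j\<in>{i..<n}. 1 / of_nat n)"
      using assms
      by (intro sum.mono_neutral_cong_right) (auto simp: averaging_tup_def tup_index upper_toeplitz_def)
    then show "(\<Sum>j<n. fst (averaging_tup c n) $$ (i, j)) = of_nat (n - i) / of_nat n" by simp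
  qed
  also have "\<dots> = complex_of_real (\<Sum>i<n. real (n - i) / real n)" by simp
  also have "(\<Sum>i<n. real (n - i) / real n) = (\<Sum>i<n. real (Suc i) / real n)"
    by (rule sum.reindex_bij_witness[of _ "\<lambda>i. n - Suc i" "\<lambda>i. n - Suc i"]) auto
  also have "\<dots> = (\<Sum>i<n. real (Suc i)) / real n" by (simp only: sum_divide_distrib)
  also have "(\<Sum>i<n. real (Suc i)) = real n * (real n + 1) / 2"
    by (induction n) (auto simp: field_simps)
  finally have "mean n (averaging_tup c) = complex_of_real ((real n + 1) / (2 * real n))"
    using assms by (simp add: mean_def field_simps)
  then show ?thesis using assms by (simp only: norm_of_real) (simp add: field_simps)
qed

context
  fixes c :: "nat \<Rightarrow> real"
  assumes c: "\<And>n. n \<ge> 1 \<Longrightarrow> c n \<ge> 1"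
begin

lemma c_nonzero: "n \<ge> 1 \<Longrightarrow> c n \<noteq> 0"
  using c[of n] by simp

text \<open>A rate \<open>C/k\<close> from some \<open>k0\<close> on fits both kinds of elements to
  be exhibited: \<open>C = 0\<close> for the block units, \<open>C = 3\<close> for the averaging
  element.\<close>

lemma A_algI:
  assumes "a \<in> N_alg c"
    and "\<And>k. k \<ge> k0 \<Longrightarrow> Norm M_alg (Minus M_alg (Times M_alg a (u_tup c k)) a) \<le> C / real k"
    and "\<And>k. k \<ge> k0 \<Longrightarrow> Norm M_alg (Minus M_alg (Times M_alg (u_tup c k) a) a) \<le> C / real k"
  shows "a \<in> A_alg c"
proof -
  let ?d = "\<lambda>k. Norm M_alg (Minus M_alg (Times M_alg a (u_tup c k)) a)
         + Norm M_alg (Minus M_alg (Times M_alg (u_tup c k) a) a)"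
  have M: "a \<in> Carr M_alg" "u_tup c k \<in> Carr M_alg" for k
    using assms(1) u_tup_in_N_alg[OF c] unfolding N_alg_def by auto
  have "0 \<le> ?d k" for k
    using M by (intro add_nonneg_nonneg M_alg_norm_nonneg M.minus_closed M.times_closed)
  then have 1: "eventually (\<lambda>k. 0 \<le> ?d k) sequentially" by (rule always_eventually[OF allI])
  have 2: "eventually (\<lambda>k. ?d k \<le> 2 * C / real k) sequentially"
    using eventually_ge_at_top[of k0]
  proof eventually_elim
    case (elim k)
    show ?case using add_mono[OF assms(2,3)[OF elim]] by simp
  qed
  have "?d \<longlonglongrightarrow> 0"
    by (rule tendsto_sandwich[OF 1 2 tendsto_const lim_const_over_n])
  then show ?thesis using assms(1) by (simp add: A_alg_def del: M_alg_simps)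
qed

lemma block_unit_in_N_alg: "block_unit c m \<in> N_alg c"
  and block_unit_norm: "Norm M_alg (block_unit c m) \<le> 1"
proof -
  let ?x = "\<lambda>n. if n \<le> m then 1\<^sub>m n else 0\<^sub>m n n"
  have *: "opnorm (?x n) \<le> 1" "opnorm (d_mat c n * ?x n * d_inv c n) \<le> 1" if "n \<ge> 1" for n
    using c_nonzero[OF that] by (auto simp: d_conj_zero d_conj_one opnorm_one opnorm_zero)
  show "block_unit c m \<in> N_alg c"
    unfolding block_unit_def using * by (intro N_algI[where K = 1]) auto
  show "Norm M_alg (block_unit c m) \<le> 1"
    unfolding block_unit_def using * by (intro tup_norm_le)
qed

text \<open>A nonzero block has index \<open>n \<le> m\<close>. From \<open>k = Suc m\<close> on
  this means \<open>n < k\<close>, where \<open>u_mat n k\<close> is the identity by convention, so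
  both defects vanish exactly.\<close>

lemma block_unit_in_A_alg: "block_unit c m \<in> A_alg c"
proof (rule A_algI[where C = 0 and ?k0.0 = "Suc m", OF block_unit_in_N_alg])
  fix k assume k: "k \<ge> Suc m"
  let ?x = "\<lambda>n. if n \<le> m then 1\<^sub>m n else 0\<^sub>m n n :: complex mat"
  have u: "u_mat n k \<in> carrier_mat n n" for n by (simp add: u_mat_eq)
  have "Minus M_alg (Times M_alg (block_unit c m) (u_tup c k)) (block_unit c m) =
      tup c (\<lambda>n. ?x n * u_mat n k + (- 1) \<cdot>\<^sub>m ?x n)"
    unfolding block_unit_def u_tup_def using u c_nonzero
    by (intro tup_times_minus) auto
  also have "\<dots> = tup c (\<lambda>n. 0\<^sub>m n n)"
  proof (rule tup_eqI)
    fix n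
    show "?x n * u_mat n k + (- 1) \<cdot>\<^sub>m ?x n = 0\<^sub>m n n"
    proof (cases "n \<le> m")
      case True
      then have "u_mat n k = 1\<^sub>m n" using k by (simp add: u_mat_def)
      then show ?thesis using True by (simp; intro eq_matI; auto)
    next
      case False
      then show ?thesis using left_mult_zero_mat[OF u] by (simp; intro eq_matI; auto)
    qed
  qed
  finally show "Norm M_alg (Minus M_alg (Times M_alg (block_unit c m) (u_tup c k)) (block_unit c m)) \<le> 0 / real k"
    using tup_norm_le[of "\<lambda>n. 0\<^sub>m n n" 0 c] by (simp add: d_conj_zero opnorm_zero)
  have "Minus M_alg (Times M_alg (u_tup c k) (block_unit c m)) (block_unit c m) =
      tup c (\<lambda>n. u_mat n k * ?x n + (- 1) \<cdot>\<^sub>m ?x n)"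
    unfolding block_unit_def u_tup_def using u c_nonzero
    by (intro tup_times_minus) auto
  also have "\<dots> = tup c (\<lambda>n. 0\<^sub>m n n)"
  proof (rule tup_eqI)
    fix n
    show "u_mat n k * ?x n + (- 1) \<cdot>\<^sub>m ?x n = 0\<^sub>m n n"
    proof (cases "n \<le> m")
      case True
      then have "u_mat n k = 1\<^sub>m n" using k by (simp add: u_mat_def)
      then show ?thesis using True by (simp; intro eq_matI; auto)
    next
      case False
      then show ?thesis using right_mult_zero_mat[OF u] by (simp; intro eq_matI; auto)
    qed
  qed
  finally show "Norm M_alg (Minus M_alg (Times M_alg (u_tup c k) (block_unit c m)) (block_unit c m)) \<le> 0 / real k"
    using tup_norm_le[of "\<lambda>n. 0\<^sub>m n n" 0 c] by (simp add: d_conj_zero opnorm_zero)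
qed

text \<open>In each block both factors are polynomials in the shift and commute, so a single
  estimate serves both defects. Its coefficients are those of
  \<open>averaging_defect\<close>.\<close>

lemma averaging_tup_in_A_alg: "averaging_tup c \<in> A_alg c"
proof (rule A_algI[where C = 3 and ?k0.0 = 1])
  show "averaging_tup c \<in> N_alg c"
    unfolding averaging_tup_def
    by (rule N_algI[where K = 1])
      (auto intro!: opnorm_upper_toeplitz opnorm_d_conj_upper_toeplitz c simp: norm_divide)
next
  fix k :: nat assume k: "k \<ge> 1"
  let ?a = "\<lambda>n. upper_toeplitz n (\<lambda>_. 1 / of_nat n)"
  let ?h = "\<lambda>n t. complex_of_real (1 / real n * (\<Sum>i\<le>t. u_coeff n k i) - 1 / real n)"
  have ua: "u_mat n k * ?a n = ?a n * u_mat n k" for n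
    by (simp add: u_mat_eq upper_toeplitz_commute)
  have prod: "u_mat n k * ?a n + (- 1) \<cdot>\<^sub>m ?a n = upper_toeplitz n (?h n)" for n
    by (simp add: u_mat_eq upper_toeplitz_mult upper_toeplitz_add upper_toeplitz_smult
        sum_divide_distrib)
  have "opnorm (upper_toeplitz n (?h n)) \<le> 3 / real k"
    "opnorm (d_mat c n * upper_toeplitz n (?h n) * d_inv c n) \<le> 3 / real k" if "n \<ge> 1" for n
  proof -
    have "(\<Sum>t<n. cmod (?h n t)) \<le> 3 / real k"
      using averaging_defect[OF k that] by (simp only: norm_of_real)
    then show "opnorm (upper_toeplitz n (?h n)) \<le> 3 / real k"
      "opnorm (d_mat c n * upper_toeplitz n (?h n) * d_inv c n) \<le> 3 / real k"
      using c[OF that] by (auto intro: opnorm_upper_toeplitz opnorm_d_conj_upper_toeplitz)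
  qed
  then have le: "Norm M_alg (tup c (\<lambda>n. upper_toeplitz n (?h n))) \<le> 3 / real k"
    by (intro tup_norm_le)
  have u: "u_mat n k \<in> carrier_mat n n" for n by (simp add: u_mat_eq)
  have 1: "Minus M_alg (Times M_alg (u_tup c k) (averaging_tup c)) (averaging_tup c) =
      tup c (\<lambda>n. upper_toeplitz n (?h n))"
    unfolding averaging_tup_def u_tup_def prod[symmetric] using u c_nonzero
    by (intro tup_times_minus) auto
  have 2: "Minus M_alg (Times M_alg (averaging_tup c) (u_tup c k)) (averaging_tup c) =
      tup c (\<lambda>n. upper_toeplitz n (?h n))"
    unfolding averaging_tup_def u_tup_def prod[symmetric] ua using u c_nonzero
    by (intro tup_times_minus) auto
  show "Norm M_alg (Minus M_alg (Times M_alg (averaging_tup c) (u_tup c k)) (averaging_tup c)) \<le> 3 / real k"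
    unfolding 2 by (rule le)
  show "Norm M_alg (Minus M_alg (Times M_alg (u_tup c k) (averaging_tup c)) (averaging_tup c)) \<le> 3 / real k"
    unfolding 1 by (rule le)
qed

lemma A_alg_normed_algebra: "normed_algebra (subalg M_alg (A_alg c))"
  unfolding A_alg_def
proof (rule M.normed_algebra_approximately_fixed)
  show "N_alg c \<subseteq> Carr M_alg" by (simp add: N_alg_def)
  show "u_tup c k \<in> Carr M_alg" for k using u_tup_in_N_alg[OF c] by (simp add: N_alg_def)
  show "{a \<in> N_alg c. (\<lambda>k. Norm M_alg (Minus M_alg (Times M_alg a (u_tup c k)) a)
         + Norm M_alg (Minus M_alg (Times M_alg (u_tup c k) a) a)) \<longlonglongrightarrow> 0} \<noteq> {}"
    using averaging_tup_in_A_alg unfolding A_alg_def by blast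
qed (rule N_alg_closed[OF c_nonzero]; assumption)+

lemma block_unit_mult: "Times M_alg (block_unit c m) (block_unit c k) = block_unit c (min m k)"
  unfolding block_unit_def
  by (subst tup_times) (auto intro!: tup_eqI simp: c_nonzero)

lemma mat_adjoint_one: "mat_adjoint (1\<^sub>m n :: complex mat) = 1\<^sub>m n"
  by (intro eq_matI) auto

lemma mat_adjoint_zero: "mat_adjoint (0\<^sub>m n n :: complex mat) = 0\<^sub>m n n"
  by (intro eq_matI) auto

lemma block_unit_star: "Star M_alg (block_unit c m) = block_unit c m"
  unfolding block_unit_def
  by (rule M_alg_eqI)
    (auto simp: tup_index d_conj_zero d_conj_one c_nonzero mat_adjoint_one mat_adjoint_zero)

section \<open>An open projection over \<open>A\<close> that is not closed\<close>

interpretation P: approximate_projections M_alg "A_alg c" "block_unit c"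
proof (intro approximate_projections.intro approximate_projections_axioms.intro)
  show "normed_star_algebra M_alg" by (rule M.normed_star_algebra_axioms)
  show "normed_algebra (subalg M_alg (A_alg c))" by (rule A_alg_normed_algebra)
  show "A_alg c \<subseteq> Carr M_alg" by (auto simp: A_alg_def N_alg_def)
qed (rule block_unit_in_A_alg block_unit_norm block_unit_star block_unit_mult)+

lemma not_nc_discrete_A_alg: "\<not> nc_discrete M_alg (A_alg c)"
proof
  assume nc: "nc_discrete M_alg (A_alg c)"
  obtain G :: "nat filter" where G: "G \<noteq> bot" "G \<le> sequentially"
    "\<And>x::nat \<Rightarrow> complex. Bseq x \<Longrightarrow> \<exists>l. (x \<longlongrightarrow> l) G"
    using generalized_limit_filter[where 'a = complex] by blast
  interpret P: open_limit M_alg "A_alg c" "block_unit c" G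
    by unfold_locales (use G in auto)
  have sub: "x \<in> Carr M_alg" if "x \<in> A_alg c" for x using that P.sub by blast
  have index: "fst (x n) \<in> carrier_mat n n" if "x \<in> A_alg c" "n \<ge> 1" for x n
    using M_algD(2)[OF sub] that by blast
  \<comment> \<open>Here \<open>K = 1\<close> because vector states are contractive, and
    \<open>\<delta> = 1/2\<close> is the lower bound of \<open>(n + 1)/(2n)\<close>.\<close>
  have "\<not> closed_projection M_alg (A_alg c) P.q"
  proof (rule P.q_not_closed[where \<tau> = mean and a = "averaging_tup c" and K = 1 and \<delta> = "1 / 2"])
    fix n :: nat and x y assume x: "x \<in> A_alg c" and y: "y \<in> A_alg c"
    \<comment> \<open>Tuples carry information from index 1 on; at \<open>n = 0\<close> both sides
      are empty sums.\<close>
    show "mean n (Plus M_alg x y) = mean n x + mean n y"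
    proof (cases "n = 0")
      case False
      then show ?thesis using index[OF x, of n] index[OF y, of n]
        by (simp add: mean_def sum.distrib add_divide_distrib)
    qed (simp add: mean_def)
  next
    fix n :: nat and z x assume x: "x \<in> A_alg c"
    show "mean n (Scale M_alg z x) = z * mean n x"
    proof (cases "n = 0")
      case False
      then show ?thesis using index[OF x, of n]
        by (simp add: mean_def sum_distrib_left)
    qed (simp add: mean_def)
  next
    fix n :: nat and x assume "x \<in> A_alg c"
    then show "cmod (mean n x) \<le> 1 * Norm M_alg x" using mean_bound sub by simp
  next
    fix n m :: nat and x assume x: "x \<in> A_alg c" and "n \<le> m"
    then show "mean n (Times M_alg (block_unit c m) x) = mean n x"
      using index[OF x, of n] by (cases "n = 0") (simp_all add: mean_def block_unit_def tup_index)
  next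
    fix n m :: nat and x assume x: "x \<in> A_alg c" and "m < n"
    then show "mean n (Times M_alg (block_unit c m) x) = 0"
      using index[OF x, of n] by (simp add: mean_def block_unit_def tup_index)
  next
    show "averaging_tup c \<in> A_alg c" by (rule averaging_tup_in_A_alg)
    show "eventually (\<lambda>n. 1 / 2 \<le> cmod (mean n (averaging_tup c))) sequentially"
      using eventually_ge_at_top[of 1] by eventually_elim (rule mean_averaging_tup)
  qed simp
  then show False using nc P.q_open unfolding nc_discrete_def by blast
qed

end

theorem corollary2p13:
  fixes c :: "nat \<Rightarrow> real"
  assumes "\<And>n. n \<ge> 1 \<Longrightarrow> c n > 1"
    and "mono_on {1..} c"
    and "\<not> bdd_above (c ` {1..})"
  shows "\<not> nc_discrete M_alg (A_alg c)"
  using assms(1) by (intro not_nc_discrete_A_alg) (simp add: less_imp_le)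

end
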